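(* Let $d\ge1$ be an integer. (i) The rotation operator $\mathcal R_d\colon\mathcal S_{\mathrm{rad}}(\mathbb R)\to\mathcal S_{\mathrm{rad}}(\mathbb R^d)$, $\mathcal R_d\psi:=\psi\circ\|\cdot\|$, is (well-defined,) linear and continuous. In particular, there exist constants $b_m>0$ such that $\|\mathcal R_d\psi\|_m\le b_m\|\psi\|_{4m}$ for all $\psi\in\mathcal S_{\mathrm{rad}}(\mathbb R)$ and all $m\in\mathbb N$. (ii) The averaging operator $\mathcal A_d\colon\mathcal S(\mathbb R^d)\to\mathcal S_{\mathrm{rad}}(\mathbb R)$, $\mathcal A_d\varphi(r):=\frac1{\omega_{d-1}}\int_{\mathbb S^{d-1}}\varphi(r\xi)\,\mathrm d\xi$ for $r\in\mathbb R$, is well-defined and continuous with $\|\mathcal A_d\varphi\|_m\le d^m\|\varphi\|_m$ for all $\varphi\in\mathcal S(\mathbb R^d)$ and all $m\in\mathbb N$.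
   Context: $\mathbb N=\{0,1,2,\dots\}$; $\|\cdot\|$ (without index) is the Euclidean norm; $\omega_{d-1}=\frac{2\pi^{d/2}}{\Gamma(d/2)}$ is the surface measure of the unit sphere $\mathbb S^{d-1}\subset\mathbb R^d$ (for $d=1$, $\mathcal A_1\varphi(r)=\frac12(\varphi(r)+\varphi(-r))$). For $\varphi\in\mathcal C^\infty(\mathbb R^d)$ and $m\in\mathbb N$ put $\|\varphi\|_m:=\max_{\beta\in\mathbb N^d,\,|\beta|\le m}\ \sup_{x\in\mathbb R^d}\big|(1+\|x\|)^mD^\beta\varphi(x)\big|$, where $|\beta|=\sum_k\beta_k$. The Schwartz space $\mathcal S(\mathbb R^d)$ consists of all $\varphi\in\mathcal C^\infty(\mathbb R^d)$ with $\|\varphi\|_m<\infty$ for all $m\in\mathbb N$, and $\varphi_n\to\varphi$ in $\mathcal S(\mathbb R^d)$ if $\|\varphi_n-\varphi\|_m\to0$ for all $m$. $\mathcal S_{\mathrm{rad}}(\mathbb R^d):=\{\varphi\in\mathcal S(\mathbb R^d):\varphi\circ Q=\varphi\text{ for all orthogonal }Q\in\mathrm O(d)\}$; in particular $\mathcal S_{\mathrm{rad}}(\mathbb R)$ consists of the even Schwartz functions. *)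

theory Defs
  imports "HOL-Analysis.Analysis"
begin

definition partial_deriv ::
  "'a::euclidean_space \<Rightarrow> ('a \<Rightarrow> 'b::real_normed_vector) \<Rightarrow> 'a \<Rightarrow> 'b" where
  "partial_deriv b f x = vector_derivative (\<lambda>t. f (x + t *\<^sub>R b)) (at 0)"

primrec times_cont_diff ::
  "nat \<Rightarrow> ('a::euclidean_space \<Rightarrow> 'b::real_normed_vector) \<Rightarrow> bool" where
  "times_cont_diff 0 f \<longleftrightarrow> continuous_on UNIV f"
| "times_cont_diff (Suc k) f \<longleftrightarrow>
     (\<forall>x. f differentiable (at x)) \<and> (\<forall>b\<in>Basis. times_cont_diff k (partial_deriv b f))"

definition smooth :: "('a::euclidean_space \<Rightarrow> 'b::real_normed_vector) \<Rightarrow> bool" where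
  "smooth f \<longleftrightarrow> (\<forall>k. times_cont_diff k f)"

definition basis_list :: "'a::euclidean_space list" where
  "basis_list = (SOME bs. distinct bs \<and> set bs = Basis)"

lemma basis_list: "distinct (basis_list :: 'a::euclidean_space list)"
    "set (basis_list :: 'a list) = Basis"
proof -
  have "\<exists>bs::'a list. distinct bs \<and> set bs = Basis"
    using finite_distinct_list[OF finite_Basis] by blast
  then have "distinct (basis_list :: 'a list) \<and> set (basis_list :: 'a list) = Basis"
    unfolding basis_list_def by (rule someI_ex)
  then show "distinct (basis_list :: 'a list)" "set (basis_list :: 'a list) = Basis"
    by auto
qed

text \<open>
  A multi-index assigns an order of differentiation to every coordinate direction.  The partial
  derivatives are taken in the order of the arbitrary enumeration \<open>basis_list\<close>; for smooth
  functions, the only ones this is used for, the order is irrelevant.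
\<close>

definition multi_deriv ::
  "('a::euclidean_space \<Rightarrow> nat) \<Rightarrow> ('a \<Rightarrow> 'b::real_normed_vector) \<Rightarrow> 'a \<Rightarrow> 'b" where
  "multi_deriv \<beta> f = foldr (\<lambda>b. partial_deriv b ^^ \<beta> b) basis_list f"

definition multi_indices :: "nat \<Rightarrow> ('a::euclidean_space \<Rightarrow> nat) set" where
  "multi_indices m = {\<beta>. (\<forall>b. b \<notin> Basis \<longrightarrow> \<beta> b = 0) \<and> (\<Sum>b\<in>Basis. \<beta> b) \<le> m}"

text \<open>
  The norms take values in \<^typ>\<open>ennreal\<close>, so that they make sense for every function and
  finiteness is a genuine condition.  The supremum over the multi-indices ranges over a finite
  nonempty set, hence is a maximum.
\<close>

definition schwartz_norm :: "nat \<Rightarrow> ('a::euclidean_space \<Rightarrow> complex) \<Rightarrow> ennreal" where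
  "schwartz_norm m \<phi> =
     (SUP \<beta>\<in>multi_indices m. SUP x. ennreal (norm ((1 + norm x) ^ m *\<^sub>R multi_deriv \<beta> \<phi> x)))"

definition schwartz :: "('a::euclidean_space \<Rightarrow> complex) set" where
  "schwartz = {\<phi>. smooth \<phi> \<and> (\<forall>m. schwartz_norm m \<phi> < \<infinity>)}"

definition schwartz_rad :: "('a::euclidean_space \<Rightarrow> complex) set" where
  "schwartz_rad = {\<phi>\<in>schwartz. \<forall>Q. orthogonal_transformation Q \<longrightarrow> \<phi> \<circ> Q = \<phi>}"

definition schwartz_tendsto ::
  "(nat \<Rightarrow> 'a::euclidean_space \<Rightarrow> complex) \<Rightarrow> ('a \<Rightarrow> complex) \<Rightarrow> bool" where
  "schwartz_tendsto \<phi>s \<phi> \<longleftrightarrow>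
     (\<forall>m. (\<lambda>n. schwartz_norm m (\<lambda>x. \<phi>s n x - \<phi> x)) \<longlonglongrightarrow> 0)"

text \<open>
  The topology is metrizable (countably many norms), so continuity is sequential continuity.
\<close>

definition schwartz_continuous_on ::
  "('a::euclidean_space \<Rightarrow> complex) set \<Rightarrow>
   (('a \<Rightarrow> complex) \<Rightarrow> ('b::euclidean_space \<Rightarrow> complex)) \<Rightarrow> bool" where
  "schwartz_continuous_on S T \<longleftrightarrow>
     (\<forall>\<phi>s \<phi>. (\<forall>n. \<phi>s n \<in> S) \<and> \<phi> \<in> S \<and> schwartz_tendsto \<phi>s \<phi>
        \<longrightarrow> schwartz_tendsto (\<lambda>n. T (\<phi>s n)) (T \<phi>))"

text \<open>
  The surface measure of a Borel set \<open>A\<close> of unit vectors is \<open>d\<close> times the Lebesgue measure of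
  the cone \<open>{t *\<^sub>R \<xi> | \<xi> \<in> A, 0 < t < 1}\<close> over it, as dictated by integration in polar
  coordinates.  For \<open>d = 1\<close> this is the counting measure on \<open>{-1, 1}\<close>.
\<close>

definition sphere_measure :: "'a::euclidean_space measure" where
  "sphere_measure = scale_measure (of_nat DIM('a))
     (distr (restrict_space lborel (ball 0 1 - {0})) (restrict_space borel (sphere 0 1)) sgn)"

text \<open>The constant \<open>\<omega>\<^bsub>d-1\<^esub>\<close>, indexed by the dimension \<open>d\<close> of the ambient space.\<close>

definition unit_sphere_area :: "nat \<Rightarrow> real" where
  "unit_sphere_area d = 2 * pi powr (real d / 2) / Gamma (real d / 2)"

lemma emeasure_sphere_measure:
  "emeasure (sphere_measure :: 'a::euclidean_space measure) (sphere 0 1)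
     = ennreal (unit_sphere_area DIM('a))"
proof -
  let ?M = "restrict_space lborel (ball 0 1 - {0::'a})"
  have B: "ball 0 1 - {0::'a} \<in> sets lborel"
    by auto
  have meas: "(sgn :: 'a \<Rightarrow> 'a) \<in> measurable ?M (restrict_space borel (sphere 0 1))"
    by (rule measurable_restrict_space3)
       (auto simp: norm_sgn sgn_div_norm[abs_def])
  have "emeasure (distr ?M (restrict_space borel (sphere 0 1)) sgn) (sphere 0 1)
      = emeasure ?M (sgn -` sphere 0 1 \<inter> space ?M)"
    by (rule emeasure_distr[OF meas]) (auto simp: sets_restrict_space)
  also have "sgn -` sphere 0 1 \<inter> space ?M = ball 0 1 - {0::'a}"
    by (auto simp: space_restrict_space norm_sgn)
  also have "emeasure ?M (ball 0 1 - {0}) = emeasure lborel (ball 0 1 - {0::'a})"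
    using B by (intro emeasure_restrict_space) auto
  also have "\<dots> = emeasure lborel (ball 0 1 :: 'a set)"
    by (rule emeasure_Diff_null_set) (auto simp: null_sets_def)
  also have "\<dots> = ennreal (unit_ball_vol DIM('a))"
    using emeasure_ball[of 1 "0::'a"] by simp
  finally have "emeasure (sphere_measure :: 'a measure) (sphere 0 1)
      = ennreal (real DIM('a) * unit_ball_vol DIM('a))"
    by (simp add: sphere_measure_def ennreal_mult' ennreal_of_nat_eq_real_of_nat)
  also have "real DIM('a) * unit_ball_vol DIM('a) = unit_sphere_area DIM('a)"
  proof -
    have "Gamma (real DIM('a) / 2 + 1) = (real DIM('a) / 2) * Gamma (real DIM('a) / 2)"
      using nonpos_Ints_nonpos[of "real DIM('a) / 2"] by (intro Gamma_plus1) force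
    then show ?thesis
      unfolding unit_sphere_area_def unit_ball_vol_def by (simp only:) simp
  qed
  finally show ?thesis .
qed

definition rotation_op :: "(real \<Rightarrow> complex) \<Rightarrow> 'a::euclidean_space \<Rightarrow> complex" where
  "rotation_op \<psi> = \<psi> \<circ> norm"

definition averaging_op :: "('a::euclidean_space \<Rightarrow> complex) \<Rightarrow> real \<Rightarrow> complex" where
  "averaging_op \<phi> r =
     (1 / unit_sphere_area DIM('a)) *\<^sub>R (LINT \<xi>|sphere_measure. \<phi> (r *\<^sub>R \<xi>))"

end

(*
  For even g, Hadamard's formula shows that g'(r)/r is again an even Schwartz function, with norms
  controlled by those of g: near 0 it is the average of g''(rs) over 0 < s < 1, away from 0 one uses
  the Leibniz rule for r * (g'(r)/r). Since the b-th partial derivative of g(|x|) is x_b times the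
  radial function built from g'(r)/r, smoothness and decay of g(|x|) follow by induction on the order.

  The spherical mean is differentiated under the integral sign: each derivative in r produces a sum
  over the d coordinates of means of partial derivatives with weights bounded by 1, and |r xi| = |r|
  on the sphere, so the decay is inherited with a factor d per derivative. The partial derivatives
  arise in arbitrary order, which is why their symmetry is needed.
*)
theory Submission
  imports Defs
begin

section \<open>Calculus of iterated partial derivatives\<close>

text \<open>The function \<open>norm\<close> is not differentiable at the origin; composing with it
  preserves smoothness only because evenness makes the odd derivatives of \<open>g\<close> vanish
  there. Writing g'(r)/r as an average of g'' never divides by r, so smoothness across 0 comes from
  differentiating under the integral. The average does not show decay, however: for small s the
  point r s stays near 0 however large r is. This is why estimates away from 0 go back to the
  product r * (g'(r)/r), where dividing by r costs nothing.

  Continuity of both operators is read off from the norm estimates, because both operators respect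
  differences. The constants therefore have to be fixed before the function is.\<close>

lemma has_derivative_along_line:
  assumes "(f has_derivative D) (at (x + t *\<^sub>R b))"
  shows "((\<lambda>t. f (x + t *\<^sub>R b)) has_vector_derivative D b) (at t within S)"
proof -
  have "((\<lambda>t. x + t *\<^sub>R b) has_derivative (\<lambda>h. h *\<^sub>R b)) (at t within S)"
    by (auto intro!: derivative_eq_intros)
  from has_derivative_compose[OF this assms]
  have "((\<lambda>t. f (x + t *\<^sub>R b)) has_derivative (\<lambda>h. D (h *\<^sub>R b))) (at t within S)" .
  moreover have "D (h *\<^sub>R b) = h *\<^sub>R D b" for h
    using assms by (simp add: has_derivative_linear linear_cmul)
  ultimately show ?thesis
    by (simp add: has_vector_derivative_def)
qed

lemma partial_deriv_eq:
  assumes "(f has_derivative D) (at x)"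
  shows "partial_deriv b f x = D b"
  unfolding partial_deriv_def
  by (rule vector_derivative_at, rule has_derivative_along_line) (use assms in simp)

lemma partial_deriv_along_line:
  assumes "f differentiable (at (x + t *\<^sub>R b))"
  shows "((\<lambda>t. f (x + t *\<^sub>R b)) has_vector_derivative partial_deriv b f (x + t *\<^sub>R b)) (at t within S)"
  using assms has_derivative_along_line partial_deriv_eq unfolding differentiable_def by metis

lemma has_derivative_partial_deriv:
  assumes "f differentiable (at x)"
  shows "(f has_derivative (\<lambda>v. \<Sum>b\<in>Basis. (v \<bullet> b) *\<^sub>R partial_deriv b f x)) (at x)"
proof -
  obtain D where D: "(f has_derivative D) (at x)"
    using assms by (auto simp: differentiable_def)
  have "D v = (\<Sum>b\<in>Basis. (v \<bullet> b) *\<^sub>R partial_deriv b f x)" for v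
  proof -
    have lin: "linear D" using D by (rule has_derivative_linear)
    have "D v = D (\<Sum>b\<in>Basis. (v \<bullet> b) *\<^sub>R b)"
      by (simp add: euclidean_representation)
    also have "\<dots> = (\<Sum>b\<in>Basis. (v \<bullet> b) *\<^sub>R D b)"
      by (simp add: linear_sum[OF lin] linear_cmul[OF lin])
    finally show ?thesis by (simp add: partial_deriv_eq[OF D])
  qed
  then have "D = (\<lambda>v. \<Sum>b\<in>Basis. (v \<bullet> b) *\<^sub>R partial_deriv b f x)" by blast
  then show ?thesis using D by simp
qed

text \<open>Level \<open>Suc k\<close> speaks of \<open>f\<close> only through differentiability and
  through its partial derivatives, so descending needs induction; at the bottom, differentiability
  supplies continuity.\<close>

lemma times_cont_diff_SucD: "times_cont_diff (Suc k) f \<Longrightarrow> times_cont_diff k f"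
proof (induction k arbitrary: f)
  case 0
  then show ?case
    by (auto intro!: continuous_at_imp_continuous_on differentiable_imp_continuous_within)
next
  case (Suc k)
  then show ?case by (metis times_cont_diff.simps(2))
qed

section \<open>Linear, additive and product rules for partial derivatives\<close>

lemma partial_deriv_bounded_linear:
  assumes "bounded_linear L" "\<And>x. f differentiable (at x)"
  shows "partial_deriv b (\<lambda>x. L (f x)) = (\<lambda>x. L (partial_deriv b f x))"
proof
  fix x
  obtain D where D: "(f has_derivative D) (at x)"
    using assms(2)[of x] by (auto simp: differentiable_def)
  show "partial_deriv b (\<lambda>x. L (f x)) x = L (partial_deriv b f x)"
    using partial_deriv_eq[OF bounded_linear.has_derivative[OF assms(1) D]] partial_deriv_eq[OF D]
    by simp
qed

lemma partial_deriv_add: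
  assumes "\<And>x. f differentiable (at x)" "\<And>x. g differentiable (at x)"
  shows "partial_deriv b (\<lambda>x. f x + g x) = (\<lambda>x. partial_deriv b f x + partial_deriv b g x)"
proof
  fix x
  obtain D E where "(f has_derivative D) (at x)" "(g has_derivative E) (at x)"
    using assms by (meson differentiable_def)
  then show "partial_deriv b (\<lambda>x. f x + g x) x = partial_deriv b f x + partial_deriv b g x"
    using partial_deriv_eq has_derivative_add by metis
qed

lemma partial_deriv_scaleR:
  fixes f :: "'a::euclidean_space \<Rightarrow> real"
  assumes "\<And>x. f differentiable (at x)" "\<And>x. g differentiable (at x)"
  shows "partial_deriv b (\<lambda>x. f x *\<^sub>R g x)
    = (\<lambda>x. f x *\<^sub>R partial_deriv b g x + partial_deriv b f x *\<^sub>R g x)"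
proof
  fix x
  obtain D E where D: "(f has_derivative D) (at x)" and E: "(g has_derivative E) (at x)"
    using assms by (meson differentiable_def)
  show "partial_deriv b (\<lambda>x. f x *\<^sub>R g x) x = f x *\<^sub>R partial_deriv b g x + partial_deriv b f x *\<^sub>R g x"
    using partial_deriv_eq[OF has_derivative_scaleR[OF D E]] partial_deriv_eq[OF D] partial_deriv_eq[OF E]
    by simp
qed

lemma partial_deriv_const [simp]: "partial_deriv b (\<lambda>x. c) = (\<lambda>x. 0)"
  by (rule ext, rule partial_deriv_eq[of _ "\<lambda>_. 0", simplified]) simp

lemma partial_deriv_inner: "partial_deriv a (\<lambda>x. x \<bullet> b) = (\<lambda>x. a \<bullet> b)"
  by (rule ext, rule partial_deriv_eq) (auto intro!: derivative_eq_intros)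

lemma times_cont_diff_const [simp]: "times_cont_diff k (\<lambda>x. c)"
  by (induction k arbitrary: c) auto

lemma times_cont_diff_inner: "times_cont_diff k (\<lambda>x. x \<bullet> b)"
  by (cases k) (auto simp: partial_deriv_inner intro!: continuous_intros derivative_intros)

lemma times_cont_diff_bounded_linear:
  assumes L: "bounded_linear L"
  shows "times_cont_diff k f \<Longrightarrow> times_cont_diff k (\<lambda>x. L (f x))"
proof (induction k arbitrary: f)
  case 0
  then show ?case using L by (auto intro: bounded_linear.continuous_on)
next
  case (Suc k)
  then have f: "f differentiable (at x)" for x by simp
  have "(\<lambda>x. L (f x)) differentiable (at x)" for x
    using f[of x] bounded_linear.has_derivative[OF L] unfolding differentiable_def by blast
  then show ?case
    using Suc by (simp add: partial_deriv_bounded_linear[OF L f])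
qed

lemma times_cont_diff_add:
  "times_cont_diff k f \<Longrightarrow> times_cont_diff k g \<Longrightarrow> times_cont_diff k (\<lambda>x. f x + g x)"
  by (induction k arbitrary: f g) (auto intro: continuous_on_add simp: partial_deriv_add)

lemma times_cont_diff_sum:
  "(\<And>i. i \<in> I \<Longrightarrow> times_cont_diff k (f i)) \<Longrightarrow> times_cont_diff k (\<lambda>x. \<Sum>i\<in>I. f i x)"
  by (induction I rule: infinite_finite_induct) (auto intro: times_cont_diff_add)

lemma times_cont_diff_scaleR:
  "times_cont_diff k f \<Longrightarrow> times_cont_diff k g \<Longrightarrow> times_cont_diff k (\<lambda>x. f x *\<^sub>R g x)"
proof (induction k arbitrary: f g)
  case 0
  then show ?case by (auto intro: continuous_on_scaleR)
next
  case (Suc k)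
  note IH = Suc.IH
  \<comment> \<open>Each summand of the product rule keeps one factor undifferentiated, and the
    induction hypothesis wants that factor at level \<open>k\<close>.\<close>
  have low: "times_cont_diff k f" "times_cont_diff k g"
    using Suc.prems times_cont_diff_SucD by blast+
  show ?case
    using Suc.prems low by (auto simp: partial_deriv_scaleR intro!: times_cont_diff_add IH)
qed

lemma smooth_differentiable: "smooth f \<Longrightarrow> f differentiable (at x)"
  unfolding smooth_def by (metis times_cont_diff.simps(2))

lemma smooth_partial_deriv: "smooth f \<Longrightarrow> b \<in> Basis \<Longrightarrow> smooth (partial_deriv b f)"
  unfolding smooth_def by (metis times_cont_diff.simps(2))

lemma smooth_continuous: "smooth f \<Longrightarrow> continuous_on UNIV f"
  unfolding smooth_def by (metis times_cont_diff.simps(1))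

lemma smooth_add: "smooth f \<Longrightarrow> smooth g \<Longrightarrow> smooth (\<lambda>x. f x + g x)"
  by (simp add: smooth_def times_cont_diff_add)

lemma smooth_scaleR: "smooth f \<Longrightarrow> smooth g \<Longrightarrow> smooth (\<lambda>x. f x *\<^sub>R g x)"
  by (simp add: smooth_def times_cont_diff_scaleR)

lemma smooth_inner: "smooth (\<lambda>x. x \<bullet> b)"
  by (simp add: smooth_def times_cont_diff_inner)

lemma smooth_bounded_linear: "bounded_linear L \<Longrightarrow> smooth f \<Longrightarrow> smooth (\<lambda>x. L (f x))"
  by (simp add: smooth_def times_cont_diff_bounded_linear)

lemma smooth_minus: "smooth f \<Longrightarrow> smooth (\<lambda>x. - f x)"
  by (rule smooth_bounded_linear[OF bounded_linear_minus[OF bounded_linear_ident]])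

lemma smooth_diff: "smooth f \<Longrightarrow> smooth g \<Longrightarrow> smooth (\<lambda>x. f x - g x)"
  using smooth_add[of f "\<lambda>x. - g x"] smooth_minus[of g] by simp

text \<open>
  Differentiating the fundamental theorem of calculus along \<open>a\<close> in the direction \<open>b\<close>, under the
  integral sign, exchanges the two derivatives without a mean value theorem, which would not be
  available for vector-valued functions.
\<close>

lemma partial_deriv_commute:
  fixes f :: "'a::euclidean_space \<Rightarrow> 'b::banach"
  assumes f: "times_cont_diff 2 f" and a: "a \<in> Basis" and b: "b \<in> Basis"
  shows "partial_deriv a (partial_deriv b f) = partial_deriv b (partial_deriv a f)"
proof
  fix x
  let ?fa = "partial_deriv a f" and ?fb = "partial_deriv b f"
  let ?fba = "partial_deriv b ?fa"
  have f': "f differentiable (at y)" "?fa differentiable (at y)" "?fb differentiable (at y)" for y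
    using f a b by (auto simp: numeral_2_eq_2)
  have cont: "continuous_on S ?fa" "continuous_on S ?fba" for S
  proof -
    have "continuous_on UNIV ?fa"
      by (intro continuous_at_imp_continuous_on ballI differentiable_imp_continuous_within f')
    moreover have "continuous_on UNIV ?fba"
      using f a b by (auto simp: numeral_2_eq_2)
    ultimately show "continuous_on S ?fa" "continuous_on S ?fba"
      by (auto intro: continuous_on_subset)
  qed
  define F where "F t u = f (x + u *\<^sub>R b + t *\<^sub>R a)" for t u :: real
  have FTC: "F t u = F 0 u + integral {0..t} (\<lambda>s. ?fa (x + u *\<^sub>R b + s *\<^sub>R a))" if "0 \<le> t" for t u
  proof -
    have "((\<lambda>s. ?fa (x + u *\<^sub>R b + s *\<^sub>R a)) has_integral (F t u - F 0 u)) {0..t}"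
      using that unfolding F_def
      by (intro fundamental_theorem_of_calculus partial_deriv_along_line f')
    then show ?thesis by (simp add: integral_unique)
  qed
  have eq: "?fb (x + t *\<^sub>R a) = ?fb x + integral {0..t} (\<lambda>s. ?fba (x + s *\<^sub>R a))" if "0 \<le> t" for t
  proof -
    have "((\<lambda>u. integral (cbox 0 t) (\<lambda>s. ?fa (x + u *\<^sub>R b + s *\<^sub>R a))) has_vector_derivative
        integral (cbox 0 t) (\<lambda>s. ?fba (x + 0 *\<^sub>R b + s *\<^sub>R a))) (at 0 within UNIV)"
    proof (rule leibniz_rule_vector_derivative)
      show "((\<lambda>u. ?fa (x + u *\<^sub>R b + s *\<^sub>R a)) has_vector_derivative ?fba (x + u *\<^sub>R b + s *\<^sub>R a)) (at u within UNIV)"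
        for u s
        using partial_deriv_along_line[OF f'(2), where x="x + s *\<^sub>R a" and t=u and b=b]
        by (simp add: algebra_simps)
      show "(\<lambda>s. ?fa (x + u *\<^sub>R b + s *\<^sub>R a)) integrable_on cbox 0 t" for u
        by (intro integrable_continuous continuous_on_compose2[OF cont(1)[of UNIV]] continuous_intros) auto
      show "continuous_on (UNIV \<times> cbox 0 t) (\<lambda>(u, s). ?fba (x + u *\<^sub>R b + s *\<^sub>R a))"
        by (auto simp: split_beta intro!: continuous_on_compose2[OF cont(2)[of UNIV]] continuous_intros)
    qed auto
    moreover have "((\<lambda>u. F 0 u) has_vector_derivative ?fb x) (at 0)"
      using partial_deriv_along_line[OF f'(1), where x="x" and t=0 and b=b] by (simp add: F_def)
    ultimately have "((\<lambda>u. F 0 u + integral {0..t} (\<lambda>s. ?fa (x + u *\<^sub>R b + s *\<^sub>R a))) has_vector_derivative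
        ?fb x + integral {0..t} (\<lambda>s. ?fba (x + s *\<^sub>R a))) (at 0)"
      by (auto intro!: has_vector_derivative_add)
    then have "((\<lambda>u. F t u) has_vector_derivative
        ?fb x + integral {0..t} (\<lambda>s. ?fba (x + s *\<^sub>R a))) (at 0)"
      by (simp add: FTC[OF that, symmetric])
    moreover have "((\<lambda>u. F t u) has_vector_derivative ?fb (x + t *\<^sub>R a)) (at 0)"
      using partial_deriv_along_line[OF f'(1), where x="x + t *\<^sub>R a" and t=0 and b=b] by (simp add: F_def algebra_simps)
    ultimately show ?thesis by (metis vector_derivative_at)
  qed
  \<comment> \<open>The identity \<open>eq\<close> holds only for nonnegative \<open>t\<close>, so
    one-sided derivatives at 0 are compared; they are unique on a nondegenerate interval.\<close>
  have "((\<lambda>t. ?fb x + integral {0..t} (\<lambda>s. ?fba (x + s *\<^sub>R a))) has_vector_derivative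
      0 + ?fba (x + 0 *\<^sub>R a)) (at 0 within {0..1})"
    by (intro has_vector_derivative_add has_vector_derivative_const integral_has_vector_derivative
        continuous_on_compose2[OF cont(2)[of UNIV]] continuous_intros) auto
  then have "((\<lambda>t. ?fb (x + t *\<^sub>R a)) has_vector_derivative ?fba x) (at 0 within {0..1})"
    using has_vector_derivative_transform[of 0 "{0..1}" "\<lambda>t. ?fb (x + t *\<^sub>R a)"] by (simp add: eq)
  moreover have "((\<lambda>t. ?fb (x + t *\<^sub>R a)) has_vector_derivative partial_deriv a ?fb x) (at 0 within {0..1})"
    using partial_deriv_along_line[OF f'(3), where x="x" and t=0 and b=a] by simp
  ultimately show "partial_deriv a ?fb x = ?fba x"
    using vector_derivative_unique_within_closed_interval[of 0 1 0] by force
qed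

text \<open>Lists admit any order of differentiation and let one derivative be split off at either
  end. The head of the list is the derivative applied last.\<close>

definition iter_deriv ::
  "'a list \<Rightarrow> ('a::euclidean_space \<Rightarrow> 'b::real_normed_vector) \<Rightarrow> 'a \<Rightarrow> 'b" where
  "iter_deriv bs f = foldr partial_deriv bs f"

lemma iter_deriv_Nil [simp]: "iter_deriv [] f = f"
  and iter_deriv_Cons [simp]: "iter_deriv (b # bs) f = partial_deriv b (iter_deriv bs f)"
  and iter_deriv_append: "iter_deriv (bs @ cs) f = iter_deriv bs (iter_deriv cs f)"
  by (simp_all add: iter_deriv_def)

lemma smooth_iter_deriv: "smooth f \<Longrightarrow> set bs \<subseteq> Basis \<Longrightarrow> smooth (iter_deriv bs f)"
  by (induction bs) (auto intro: smooth_partial_deriv)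

lemma iter_deriv_partial_deriv:
  fixes f :: "'a::euclidean_space \<Rightarrow> 'b::banach"
  assumes "smooth f" "b \<in> Basis" "set bs \<subseteq> Basis"
  shows "iter_deriv bs (partial_deriv b f) = partial_deriv b (iter_deriv bs f)"
  using assms(3)
proof (induction bs)
  case (Cons c bs)
  then have "smooth (iter_deriv bs f)" using assms by (intro smooth_iter_deriv) auto
  then have "partial_deriv b (partial_deriv c (iter_deriv bs f)) = partial_deriv c (partial_deriv b (iter_deriv bs f))"
    using Cons.prems assms by (intro partial_deriv_commute) (auto simp: smooth_def)
  then show ?case using Cons by simp
qed simp

text \<open>The bridge between lists and multi-indices, which record only multiplicities. The head
  \<open>b\<close> occurs somewhere in \<open>cs\<close>, and commuting it past the derivatives
  before it reduces to shorter lists.\<close>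

lemma iter_deriv_mset:
  fixes f :: "'a::euclidean_space \<Rightarrow> 'b::banach"
  assumes "smooth f" "set bs \<subseteq> Basis" "mset bs = mset cs"
  shows "iter_deriv bs f = iter_deriv cs f"
  using assms(2,3)
proof (induction bs arbitrary: cs)
  case (Cons b bs)
  then obtain cs1 cs2 where cs: "cs = cs1 @ b # cs2"
    by (metis list.set_intros(1) mset_eq_setD split_list)
  have sub: "set cs \<subseteq> Basis" using Cons.prems by (metis mset_eq_setD)
  have "iter_deriv bs f = iter_deriv (cs1 @ cs2) f"
    using Cons.prems cs by (intro Cons.IH) auto
  moreover have "iter_deriv cs f = partial_deriv b (iter_deriv (cs1 @ cs2) f)"
    using sub assms(1) by (simp add: cs iter_deriv_append iter_deriv_partial_deriv smooth_iter_deriv)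
  ultimately show ?case by simp
qed simp

lemma iter_deriv_add:
  assumes "smooth f" "smooth g" "set bs \<subseteq> Basis"
  shows "iter_deriv bs (\<lambda>x. f x + g x) = (\<lambda>x. iter_deriv bs f x + iter_deriv bs g x)"
  using assms(3)
proof (induction bs)
  case (Cons b bs)
  then show ?case
    using assms by (simp add: partial_deriv_add smooth_differentiable smooth_iter_deriv)
qed simp

lemma iter_deriv_bounded_linear:
  assumes "bounded_linear L" "smooth f" "set bs \<subseteq> Basis"
  shows "iter_deriv bs (\<lambda>x. L (f x)) = (\<lambda>x. L (iter_deriv bs f x))"
  using assms(3)
proof (induction bs)
  case (Cons b bs)
  then show ?case
    using assms by (simp add: partial_deriv_bounded_linear smooth_differentiable smooth_iter_deriv)
qed simp

lemma iter_deriv_diff: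
  assumes "smooth f" "smooth g" "set bs \<subseteq> Basis"
  shows "iter_deriv bs (\<lambda>x. f x - g x) = (\<lambda>x. iter_deriv bs f x - iter_deriv bs g x)"
  using iter_deriv_add[of f "\<lambda>x. - g x" bs] assms
    iter_deriv_bounded_linear[OF bounded_linear_minus[OF bounded_linear_ident], of g bs]
  by (simp add: smooth_minus)

lemma iter_deriv_const_0 [simp]: "iter_deriv bs (\<lambda>x. 0) = (\<lambda>x. 0)"
  by (induction bs) auto

lemma smooth_const [simp]: "smooth (\<lambda>x. c)"
  by (simp add: smooth_def)

lemma smooth_sum: "(\<And>i. i \<in> I \<Longrightarrow> smooth (f i)) \<Longrightarrow> smooth (\<lambda>x. \<Sum>i\<in>I. f i x)"
  by (simp add: smooth_def times_cont_diff_sum)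

lemma iter_deriv_sum:
  assumes "\<And>i. i \<in> I \<Longrightarrow> smooth (f i)" "set bs \<subseteq> Basis"
  shows "iter_deriv bs (\<lambda>x. \<Sum>i\<in>I. f i x) = (\<lambda>x. \<Sum>i\<in>I. iter_deriv bs (f i) x)"
  using assms(1)
  by (induction I rule: infinite_finite_induct) (auto simp: iter_deriv_add smooth_sum assms(2))

text \<open>A coordinate is linear, so the Leibniz expansion stops once one derivative has hit it.
  That derivative is one of the occurrences of \<open>b\<close>, whence the multiplicity and the
  removal of a single \<open>b\<close>; all occurrences give the same term by symmetry of mixed
  derivatives.\<close>

lemma iter_deriv_inner_scaleR:
  fixes h :: "'a::euclidean_space \<Rightarrow> 'b::banach"
  assumes h: "smooth h" and b: "b \<in> Basis" and bs: "set bs \<subseteq> Basis"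
  shows "iter_deriv bs (\<lambda>x. (x \<bullet> b) *\<^sub>R h x)
    = (\<lambda>x. (x \<bullet> b) *\<^sub>R iter_deriv bs h x + real (count_list bs b) *\<^sub>R iter_deriv (remove1 b bs) h x)"
  using bs
proof (induction bs)
  case (Cons a bs)
  let ?D = "iter_deriv bs h" and ?R = "iter_deriv (remove1 b bs) h" and ?c = "real (count_list bs b)"
  have sub: "set (remove1 b bs) \<subseteq> Basis"
    using Cons.prems set_remove1_subset by fastforce
  have sm: "smooth ?D" "smooth ?R"
    using Cons.prems sub h by (auto intro: smooth_iter_deriv)
  have "iter_deriv (a # bs) (\<lambda>x. (x \<bullet> b) *\<^sub>R h x)
      = partial_deriv a (\<lambda>x. (x \<bullet> b) *\<^sub>R ?D x + ?c *\<^sub>R ?R x)"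
    using Cons by simp
  also have "\<dots> = (\<lambda>x. ((x \<bullet> b) *\<^sub>R partial_deriv a ?D x + (a \<bullet> b) *\<^sub>R ?D x) + ?c *\<^sub>R partial_deriv a ?R x)"
    using sm by (simp add: partial_deriv_add partial_deriv_scaleR partial_deriv_inner smooth_differentiable
        smooth_inner smooth_scaleR smooth_bounded_linear bounded_linear_scaleR_right
        partial_deriv_bounded_linear[OF bounded_linear_scaleR_right])
  also have "\<dots> = (\<lambda>x. (x \<bullet> b) *\<^sub>R iter_deriv (a # bs) h x
      + real (count_list (a # bs) b) *\<^sub>R iter_deriv (remove1 b (a # bs)) h x)"
  proof (cases "a = b")
    case True
    \<comment> \<open>If \<open>b\<close> occurs in \<open>bs\<close>, prepending it restores the
      removed occurrence up to order; otherwise the coefficient is zero. The term then merges with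
      the one from differentiating the coordinate, which raises the count by one.\<close>
    have *: "?c *\<^sub>R partial_deriv b ?R x = ?c *\<^sub>R ?D x" for x
    proof (cases "b \<in> set bs")
      case b_in: True
      have "iter_deriv (b # remove1 b bs) h = iter_deriv bs h"
        using b_in sub b h by (intro iter_deriv_mset) auto
      then show ?thesis by simp
    qed (simp add: count_list_0_iff)
    show ?thesis using b by (simp add: True * algebra_simps)
  next
    case False
    then show ?thesis using Cons.prems b by (auto simp: inner_Basis)
  qed
  finally show ?case .
qed simp

lemma multi_deriv_eq_iter_deriv:
  "multi_deriv \<beta> f = iter_deriv (concat (map (\<lambda>b. replicate (\<beta> b) b) basis_list)) f"
proof -
  have "(partial_deriv b ^^ n) g = iter_deriv (replicate n b) g" for b n and g :: "'a \<Rightarrow> 'b"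
    by (induction n) auto
  then have "foldr (\<lambda>b. partial_deriv b ^^ \<beta> b) bs f = iter_deriv (concat (map (\<lambda>b. replicate (\<beta> b) b) bs)) f"
    for bs
    by (induction bs) (auto simp: iter_deriv_append)
  then show ?thesis by (simp add: multi_deriv_def)
qed

section \<open>Schwartz norms and decay bounds\<close>

text \<open>Weight and order are decoupled because the radial argument spends them at different
  rates, whereas the norms tie them together. All lists of directions are allowed, so that bounds
  pass to partial derivatives, and a real \<open>K\<close> keeps the estimates in ordinary
  arithmetic.\<close>

definition decay_bound :: "nat \<Rightarrow> nat \<Rightarrow> ('a::euclidean_space \<Rightarrow> complex) \<Rightarrow> real \<Rightarrow> bool" where
  "decay_bound N n f K \<longleftrightarrow>
     (\<forall>bs x. set bs \<subseteq> Basis \<longrightarrow> length bs \<le> n \<longrightarrow> (1 + norm x) ^ N * norm (iter_deriv bs f x) \<le> K)"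

lemma decay_boundI:
  "(\<And>bs x. set bs \<subseteq> Basis \<Longrightarrow> length bs \<le> n \<Longrightarrow> (1 + norm x) ^ N * norm (iter_deriv bs f x) \<le> K)
    \<Longrightarrow> decay_bound N n f K"
  by (simp add: decay_bound_def)

lemma decay_boundD:
  "decay_bound N n f K \<Longrightarrow> set bs \<subseteq> Basis \<Longrightarrow> length bs \<le> n
    \<Longrightarrow> (1 + norm x) ^ N * norm (iter_deriv bs f x) \<le> K"
  by (simp add: decay_bound_def)

lemma decay_bound_nonneg: "decay_bound N n f K \<Longrightarrow> 0 \<le> K"
  by (rule order_trans[OF _ decay_boundD[of N n f K "[]" 0]]) auto

lemma decay_bound_norm_le:
  assumes "decay_bound N n f K" "set bs \<subseteq> Basis" "length bs \<le> n"
  shows "norm (iter_deriv bs f x) \<le> K"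
proof -
  have "1 * norm (iter_deriv bs f x) \<le> (1 + norm x) ^ N * norm (iter_deriv bs f x)"
    by (intro mult_right_mono one_le_power) auto
  then show ?thesis using decay_boundD[OF assms, of x] by linarith
qed

lemma decay_bound_mono:
  assumes "decay_bound N n f K" "N' \<le> N" "n' \<le> n" "K \<le> K'"
  shows "decay_bound N' n' f K'"
proof (rule decay_boundI)
  fix bs :: "'a list" and x :: 'a
  assume bs: "set bs \<subseteq> Basis" "length bs \<le> n'"
  have "(1 + norm x) ^ N' * norm (iter_deriv bs f x) \<le> (1 + norm x) ^ N * norm (iter_deriv bs f x)"
    using assms(2) by (intro mult_right_mono power_increasing) auto
  also have "\<dots> \<le> K" using bs assms by (intro decay_boundD[of N n]) auto
  finally show "(1 + norm x) ^ N' * norm (iter_deriv bs f x) \<le> K'" using assms(4) by simp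
qed

lemma decay_bound_partial_deriv:
  assumes "decay_bound N (Suc n) f K" "b \<in> Basis"
  shows "decay_bound N n (partial_deriv b f) K"
proof (rule decay_boundI)
  fix bs :: "'a list" and x :: 'a
  assume "set bs \<subseteq> Basis" "length bs \<le> n"
  then show "(1 + norm x) ^ N * norm (iter_deriv bs (partial_deriv b f) x) \<le> K"
    using decay_boundD[OF assms(1), of "bs @ [b]" x] assms(2) by (simp add: iter_deriv_append)
qed

text \<open>Since a coordinate of x is at most 1 + |x| in absolute value, it uses up one power of
  the weight. The Leibniz correction has multiplicity at most \<open>n\<close>, which explains the
  factor \<open>1 + real n\<close>.\<close>

lemma decay_bound_inner_scaleR:
  assumes h: "smooth h" "decay_bound (Suc N) n h K" and b: "b \<in> Basis"
  shows "decay_bound N n (\<lambda>x. (x \<bullet> b) *\<^sub>R h x) ((1 + real n) * K)"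
proof (rule decay_boundI)
  fix bs :: "'a list" and x :: 'a
  assume bs: "set bs \<subseteq> Basis" "length bs \<le> n"
  let ?w = "(1 + norm x) ^ N"
  have sub: "set (remove1 b bs) \<subseteq> Basis" "length (remove1 b bs) \<le> n"
    using bs set_remove1_subset[of b bs] by (auto simp: length_remove1)
  have "\<bar>x \<bullet> b\<bar> \<le> 1 + norm x"
    using Basis_le_norm[OF b, of x] by linarith
  then have "?w * norm ((x \<bullet> b) *\<^sub>R iter_deriv bs h x) \<le> ?w * ((1 + norm x) * norm (iter_deriv bs h x))"
    by (auto intro!: mult_left_mono mult_right_mono)
  also have "\<dots> \<le> K"
    using decay_boundD[OF h(2) bs, of x] by (simp add: mult_ac)
  finally have 1: "?w * norm ((x \<bullet> b) *\<^sub>R iter_deriv bs h x) \<le> K" .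
  have "?w * norm (iter_deriv (remove1 b bs) h x) \<le> K"
    using decay_boundD[OF decay_bound_mono[OF h(2), of N n K] sub] by simp
  moreover have "real (count_list bs b) \<le> real n"
    using count_le_length[of bs b] bs by linarith
  ultimately have 2: "real (count_list bs b) * (?w * norm (iter_deriv (remove1 b bs) h x)) \<le> real n * K"
    by (intro mult_mono) auto
  have "?w * norm (iter_deriv bs (\<lambda>x. (x \<bullet> b) *\<^sub>R h x) x)
      \<le> ?w * (norm ((x \<bullet> b) *\<^sub>R iter_deriv bs h x) + norm (real (count_list bs b) *\<^sub>R iter_deriv (remove1 b bs) h x))"
    unfolding iter_deriv_inner_scaleR[OF h(1) b bs(1)] by (intro mult_left_mono norm_triangle_ineq) auto
  also have "\<dots> = ?w * norm ((x \<bullet> b) *\<^sub>R iter_deriv bs h x)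
      + real (count_list bs b) * (?w * norm (iter_deriv (remove1 b bs) h x))"
    by (simp add: distrib_left mult.left_commute)
  finally show "?w * norm (iter_deriv bs (\<lambda>x. (x \<bullet> b) *\<^sub>R h x) x) \<le> (1 + real n) * K"
    using 1 2 by (simp add: distrib_right)
qed

lemma schwartz_norm_le:
  fixes f :: "'a::euclidean_space \<Rightarrow> complex"
  assumes "decay_bound m m f K"
  shows "schwartz_norm m f \<le> ennreal K"
  unfolding schwartz_norm_def
proof (intro SUP_least ennreal_leI)
  fix \<beta> :: "'a \<Rightarrow> nat" and x
  assume \<beta>: "\<beta> \<in> multi_indices m"
  let ?bs = "concat (map (\<lambda>b. replicate (\<beta> b) b) basis_list)"
  have "length ?bs = (\<Sum>b\<in>Basis. \<beta> b)"
    by (simp add: length_concat o_def sum_list_distinct_conv_sum_set basis_list)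
  moreover have "set ?bs \<subseteq> Basis"
    by (auto simp: basis_list)
  ultimately show "norm ((1 + norm x) ^ m *\<^sub>R multi_deriv \<beta> f x) \<le> K"
    using decay_boundD[OF assms, of ?bs x] \<beta>
    by (simp add: multi_deriv_eq_iter_deriv multi_indices_def abs_of_nonneg)
qed

text \<open>Symmetry of mixed derivatives enters here: an arbitrary list is compared with the list
  that \<open>multi_deriv\<close> builds from its multiplicities. The sign of \<open>K\<close>
  matters because \<open>ennreal\<close> sends negative reals to 0.\<close>

lemma decay_bound_of_schwartz_norm:
  fixes f :: "'a::euclidean_space \<Rightarrow> complex"
  assumes f: "smooth f" and le: "schwartz_norm m f \<le> ennreal K" and K: "0 \<le> K"
  shows "decay_bound m m f K"
proof (rule decay_boundI)
  fix bs :: "'a list" and x :: 'a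
  assume bs: "set bs \<subseteq> Basis" "length bs \<le> m"
  let ?\<beta> = "count_list bs"
  have "?\<beta> b = 0" if "b \<notin> Basis" for b
    using that bs by (auto simp: count_list_0_iff)
  moreover have "(\<Sum>b\<in>Basis. ?\<beta> b) = length bs"
    using bs by (intro sum_count_set) auto
  ultimately have \<beta>: "?\<beta> \<in> multi_indices m"
    using bs by (simp add: multi_indices_def)
  have rep: "count_list (replicate k b) a = (if a = b then k else 0)" for k and a b :: 'a
    by (induction k) auto
  \<comment> \<open>Distinctness makes each direction contribute exactly one block of
    copies.\<close>
  have "count_list (concat (map (\<lambda>b. replicate (?\<beta> b) b) cs)) a = (if a \<in> set cs then ?\<beta> a else 0)"
    if "distinct cs" for cs a
    using that by (induction cs) (auto simp: rep)
  then have "mset (concat (map (\<lambda>b. replicate (?\<beta> b) b) basis_list)) = mset bs"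
    using bs by (intro multiset_eqI) (auto simp: count_mset basis_list count_list_0_iff)
  then have "multi_deriv ?\<beta> f = iter_deriv bs f"
    unfolding multi_deriv_eq_iter_deriv
    by (intro iter_deriv_mset f) (auto simp: basis_list)
  moreover have "ennreal (norm ((1 + norm x) ^ m *\<^sub>R multi_deriv ?\<beta> f x)) \<le> schwartz_norm m f"
    unfolding schwartz_norm_def by (intro SUP_upper2[OF \<beta>] SUP_upper) auto
  ultimately have "ennreal (norm ((1 + norm x) ^ m *\<^sub>R iter_deriv bs f x)) \<le> ennreal K"
    using le by simp
  then show "(1 + norm x) ^ m * norm (iter_deriv bs f x) \<le> K"
    using K by (simp add: abs_of_nonneg)
qed

section \<open>Schwartz functions in terms of decay bounds\<close>

lemma schwartz_iff: "f \<in> schwartz \<longleftrightarrow> smooth f \<and> (\<forall>N n. \<exists>K. decay_bound N n f K)"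
proof safe
  assume f: "f \<in> schwartz"
  then show sm: "smooth f" by (simp add: schwartz_def)
  fix N n :: nat
  \<comment> \<open>Each norm uses one index for both weight and order, so the larger demand fixes
    it.\<close>
  let ?m = "max N n"
  have "schwartz_norm ?m f < \<infinity>" using f by (simp add: schwartz_def)
  then have "decay_bound ?m ?m f (enn2real (schwartz_norm ?m f))"
    by (intro decay_bound_of_schwartz_norm sm) auto
  then show "\<exists>K. decay_bound N n f K" by (meson decay_bound_mono max.cobounded1 max.cobounded2 order_refl)
next
  assume "smooth f" and b: "\<forall>N n. \<exists>K. decay_bound N n f K"
  moreover have "schwartz_norm m f < \<infinity>" for m
    using b schwartz_norm_le[of m f] by (metis ennreal_less_top infinity_ennreal_def order_le_less_trans)
  ultimately show "f \<in> schwartz" by (simp add: schwartz_def)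
qed

lemma schwartz_smooth: "f \<in> schwartz \<Longrightarrow> smooth f"
  by (simp add: schwartz_def)

lemma schwartz_partial_deriv: "f \<in> schwartz \<Longrightarrow> b \<in> Basis \<Longrightarrow> partial_deriv b f \<in> schwartz"
  unfolding schwartz_iff using smooth_partial_deriv decay_bound_partial_deriv by meson

lemma schwartz_diff:
  fixes f g :: "'a::euclidean_space \<Rightarrow> complex"
  assumes "f \<in> schwartz" "g \<in> schwartz"
  shows "(\<lambda>x. f x - g x) \<in> schwartz"
  unfolding schwartz_iff
proof (intro conjI allI)
  have sm: "smooth f" "smooth g" using assms by (auto intro: schwartz_smooth)
  then show "smooth (\<lambda>x. f x - g x)" by (rule smooth_diff)
  fix N n
  obtain K L where K: "decay_bound N n f K" and L: "decay_bound N n g L"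
    using assms unfolding schwartz_iff by meson
  have "decay_bound N n (\<lambda>x. f x - g x) (K + L)"
  proof (rule decay_boundI)
    fix bs :: "'a list" and x :: 'a
    assume bs: "set bs \<subseteq> Basis" "length bs \<le> n"
    have "(1 + norm x) ^ N * norm (iter_deriv bs (\<lambda>x. f x - g x) x)
        \<le> (1 + norm x) ^ N * (norm (iter_deriv bs f x) + norm (iter_deriv bs g x))"
      unfolding iter_deriv_diff[OF sm bs(1)] by (intro mult_left_mono norm_triangle_ineq4) auto
    also have "\<dots> \<le> K + L"
      using decay_boundD[OF K bs, of x] decay_boundD[OF L bs, of x] by (simp add: distrib_left)
    finally show "(1 + norm x) ^ N * norm (iter_deriv bs (\<lambda>x. f x - g x) x) \<le> K + L" .
  qed
  then show "\<exists>K. decay_bound N n (\<lambda>x. f x - g x) K" by blast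
qed

lemma schwartz_rad_diff:
  assumes "f \<in> schwartz_rad" "g \<in> schwartz_rad"
  shows "(\<lambda>x. f x - g x) \<in> schwartz_rad"
  using assms schwartz_diff unfolding schwartz_rad_def by (fastforce simp: fun_eq_iff)

text \<open>Passes from real bounds to extended norms: the norm of a Schwartz function is finite and
  is therefore itself an admissible \<open>K\<close>.\<close>

lemma schwartz_norm_bound:
  assumes "\<phi> \<in> schwartz" "0 \<le> C"
    and "\<And>K. decay_bound m' m' \<phi> K \<Longrightarrow> decay_bound m m \<psi> (C * K)"
  shows "schwartz_norm m \<psi> \<le> ennreal C * schwartz_norm m' \<phi>"
proof -
  have fin: "schwartz_norm m' \<phi> < \<infinity>" using assms by (simp add: schwartz_def)
  then have "decay_bound m' m' \<phi> (enn2real (schwartz_norm m' \<phi>))"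
    using assms by (intro decay_bound_of_schwartz_norm schwartz_smooth) auto
  then have "schwartz_norm m \<psi> \<le> ennreal (C * enn2real (schwartz_norm m' \<phi>))"
    by (intro schwartz_norm_le assms)
  then show ?thesis using fin assms by (simp add: ennreal_mult)
qed

text \<open>As \<open>T\<close> respects differences, convergence at a point becomes convergence at
  0, and the norm estimate, with \<open>m'\<close> and \<open>C\<close> independent of the function,
  squeezes the norms of the images.\<close>

lemma schwartz_continuous_onI:
  assumes diff: "\<And>\<phi> \<psi>. \<phi> \<in> S \<Longrightarrow> \<psi> \<in> S \<Longrightarrow> (\<lambda>x. \<phi> x - \<psi> x) \<in> S"
    and T: "\<And>\<phi> \<psi>. \<phi> \<in> S \<Longrightarrow> \<psi> \<in> S \<Longrightarrow> T (\<lambda>x. \<phi> x - \<psi> x) = (\<lambda>y. T \<phi> y - T \<psi> y)"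
    and bound: "\<And>m. \<exists>m' C. \<forall>\<phi>\<in>S. schwartz_norm m (T \<phi>) \<le> ennreal C * schwartz_norm m' \<phi>"
  shows "schwartz_continuous_on S T"
  unfolding schwartz_continuous_on_def schwartz_tendsto_def
proof (intro allI impI)
  fix \<phi>s \<phi> m
  assume asm: "(\<forall>n. \<phi>s n \<in> S) \<and> \<phi> \<in> S \<and> (\<forall>m. (\<lambda>n. schwartz_norm m (\<lambda>x. \<phi>s n x - \<phi> x)) \<longlonglongrightarrow> 0)"
  obtain m' C where C: "\<And>\<phi>. \<phi> \<in> S \<Longrightarrow> schwartz_norm m (T \<phi>) \<le> ennreal C * schwartz_norm m' \<phi>"
    using bound by metis
  have "(\<lambda>n. ennreal C * schwartz_norm m' (\<lambda>x. \<phi>s n x - \<phi> x)) \<longlonglongrightarrow> ennreal C * 0"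
    using asm by (intro ennreal_tendsto_cmult) auto
  moreover have "schwartz_norm m (\<lambda>y. T (\<phi>s n) y - T \<phi> y)
      \<le> ennreal C * schwartz_norm m' (\<lambda>x. \<phi>s n x - \<phi> x)" for n
    using C[of "\<lambda>x. \<phi>s n x - \<phi> x"] asm by (simp add: diff T)
  ultimately show "(\<lambda>n. schwartz_norm m (\<lambda>y. T (\<phi>s n) y - T \<phi> y)) \<longlonglongrightarrow> 0"
    by - (rule tendsto_sandwich[OF always_eventually always_eventually tendsto_const], auto)
qed

section \<open>Averages over dilated families of points\<close>

text \<open>Difference quotients are the form on which dominated convergence can act.\<close>

lemma has_vector_derivative_iff_tendsto:
  "(f has_vector_derivative D) (at r) \<longleftrightarrow> ((\<lambda>h. (f (r + h) - f r) /\<^sub>R h) \<longlongrightarrow> D) (at 0)"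
proof -
  have "norm ((f (r + h) - f r) /\<^sub>R h - D) = norm (f (r + h) - f r - h *\<^sub>R D) / norm h" if "h \<noteq> 0" for h
  proof -
    have "(f (r + h) - f r) /\<^sub>R h - D = (f (r + h) - f r - h *\<^sub>R D) /\<^sub>R h"
      using that by (simp add: scaleR_diff_right)
    then show ?thesis by (simp only: norm_scaleR abs_inverse real_norm_def divide_inverse_commute)
  qed
  then have "((\<lambda>h. norm ((f (r + h) - f r) /\<^sub>R h - D)) \<longlongrightarrow> 0) (at 0)
      \<longleftrightarrow> ((\<lambda>h. norm (f (r + h) - f r - h *\<^sub>R D) / norm h) \<longlongrightarrow> 0) (at 0)"
    by (intro Lim_cong_within) auto
  then show ?thesis
    by (simp add: has_vector_derivative_def has_derivative_at bounded_linear_scaleR_left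
        LIM_zero_iff[of _ D] tendsto_norm_zero_iff)
qed

text \<open>A derivative bounded by \<open>B\<close> makes the integrand Lipschitz in
  \<open>t\<close>, so every difference quotient is dominated by the constant \<open>B\<close>,
  which is integrable because the measure is finite.\<close>

lemma (in finite_measure) has_vector_derivative_integral:
  fixes f f' :: "real \<Rightarrow> 'a \<Rightarrow> 'b::{banach, second_countable_topology}"
  assumes int: "\<And>t. integrable M (f t)" and meas: "f' r \<in> borel_measurable M"
    and deriv: "\<And>t \<omega>. \<omega> \<in> space M \<Longrightarrow> ((\<lambda>t. f t \<omega>) has_vector_derivative f' t \<omega>) (at t)"
    and bound: "\<And>t \<omega>. \<omega> \<in> space M \<Longrightarrow> norm (f' t \<omega>) \<le> B"
  shows "((\<lambda>t. LINT \<omega>|M. f t \<omega>) has_vector_derivative (LINT \<omega>|M. f' r \<omega>)) (at r)"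
proof -
  let ?q = "\<lambda>h \<omega>. (f (r + h) \<omega> - f r \<omega>) /\<^sub>R h"
  have lip: "norm (f (r + h) \<omega> - f r \<omega>) \<le> B * \<bar>h\<bar>" if \<omega>: "\<omega> \<in> space M" for h \<omega>
  proof -
    have "onorm (\<lambda>h. h *\<^sub>R f' t \<omega>) \<le> B" for t
      using bound[OF \<omega>, of t] onorm_scaleR_left[of "\<lambda>x::real. x" "f' t \<omega>"]
      by (simp add: onorm_id)
    then have "norm (f (r + h) \<omega> - f r \<omega>) \<le> B * norm (r + h - r)"
      using deriv[OF \<omega>]
      by (intro differentiable_bound[of UNIV _ "\<lambda>t h. h *\<^sub>R f' t \<omega>"])
        (auto simp: has_vector_derivative_def)
    then show ?thesis by simp
  qed
  \<comment> \<open>Dominated convergence concerns sequences, so the limit at 0 is tested along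
    sequences of nonzero increments.\<close>
  have "((\<lambda>h. LINT \<omega>|M. ?q h \<omega>) \<longlongrightarrow> (LINT \<omega>|M. f' r \<omega>)) (at 0)"
    unfolding tendsto_at_iff_sequentially o_def
  proof (intro allI impI)
    fix X :: "nat \<Rightarrow> real"
    assume X: "\<forall>i. X i \<in> UNIV - {0}" "X \<longlonglongrightarrow> 0"
    show "(\<lambda>i. LINT \<omega>|M. ?q (X i) \<omega>) \<longlonglongrightarrow> (LINT \<omega>|M. f' r \<omega>)"
    proof (rule integral_dominated_convergence)
      show "integrable M (\<lambda>_. B)" by simp
      show "(\<lambda>\<omega>. ?q (X i) \<omega>) \<in> borel_measurable M" for i
        using int[of "r + X i"] int[of r] by measurable
      show "AE \<omega> in M. (\<lambda>i. ?q (X i) \<omega>) \<longlonglongrightarrow> f' r \<omega>"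
      proof (rule AE_I2)
        fix \<omega> assume "\<omega> \<in> space M"
        from deriv[OF this, of r] have "((\<lambda>h. ?q h \<omega>) \<longlongrightarrow> f' r \<omega>) (at 0)"
          by (simp add: has_vector_derivative_iff_tendsto)
        then show "(\<lambda>i. ?q (X i) \<omega>) \<longlonglongrightarrow> f' r \<omega>"
          using X unfolding tendsto_at_iff_sequentially o_def by blast
      qed
      show "AE \<omega> in M. norm (?q (X i) \<omega>) \<le> B" for i
      proof (rule AE_I2)
        fix \<omega> assume "\<omega> \<in> space M"
        from lip[OF this, of "X i"] have "norm (f (r + X i) \<omega> - f r \<omega>) / \<bar>X i\<bar> \<le> B"
          using X by (simp add: divide_le_eq)
        then show "norm (?q (X i) \<omega>) \<le> B"
          by (simp only: norm_scaleR abs_inverse divide_inverse_commute)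
      qed
    qed (use meas in simp)
  qed
  then have "((\<lambda>h. ((LINT \<omega>|M. f (r + h) \<omega>) - (LINT \<omega>|M. f r \<omega>)) /\<^sub>R h) \<longlongrightarrow> (LINT \<omega>|M. f' r \<omega>)) (at 0)"
    using int by simp
  then show ?thesis
    by (simp add: has_vector_derivative_iff_tendsto)
qed

text \<open>
  Covers the spherical mean, where \<open>X\<close> is the identity on the unit sphere, and Hadamard's formula
  \<open>g' r / r = \<integral>\<^sub>0\<^sup>1 g'' (r s) ds\<close>, where \<open>X\<close> is the identity on the unit interval.
  The weights \<open>c\<close> are needed to have a class of averages that is closed under differentiation.
\<close>

locale unit_bounded = finite_measure M for M :: "'i measure" +
  fixes X :: "'i \<Rightarrow> 'a::euclidean_space"
  assumes X_measurable [measurable]: "X \<in> borel_measurable M"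
    and norm_X: "\<omega> \<in> space M \<Longrightarrow> norm (X \<omega>) \<le> 1"
begin

text \<open>With the bound exactly 1 and |X| at most 1, multiplication by a coordinate stays in the
  class, and repeated differentiation accumulates no constant from the weights.\<close>

definition weight :: "('i \<Rightarrow> real) \<Rightarrow> bool" where
  "weight c \<longleftrightarrow> c \<in> borel_measurable M \<and> (\<forall>\<omega>\<in>space M. \<bar>c \<omega>\<bar> \<le> 1)"

definition average :: "('i \<Rightarrow> real) \<Rightarrow> ('a \<Rightarrow> complex) \<Rightarrow> real \<Rightarrow> complex" where
  "average c \<phi> r = (LINT \<omega>|M. c \<omega> *\<^sub>R \<phi> (r *\<^sub>R X \<omega>))"

lemma weight_one: "weight (\<lambda>_. 1)"
  by (simp add: weight_def)

lemma weight_mult_inner: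
  assumes "weight c" "b \<in> Basis"
  shows "weight (\<lambda>\<omega>. c \<omega> * (X \<omega> \<bullet> b))"
proof -
  have "\<bar>c \<omega> * (X \<omega> \<bullet> b)\<bar> \<le> 1 * 1" if "\<omega> \<in> space M" for \<omega>
    unfolding abs_mult using assms that norm_X[OF that] Basis_le_norm[OF assms(2), of "X \<omega>"]
    by (intro mult_mono) (auto simp: weight_def)
  then show ?thesis using assms by (auto simp: weight_def)
qed

lemma integrable_average:
  assumes c: "weight c" and \<phi>: "\<phi> \<in> schwartz"
  shows "integrable M (\<lambda>\<omega>. c \<omega> *\<^sub>R \<phi> (r *\<^sub>R X \<omega>))"
proof -
  obtain K where K: "decay_bound 0 0 \<phi> K" using \<phi> unfolding schwartz_iff by blast
  have [measurable]: "c \<in> borel_measurable M" using c by (simp add: weight_def)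
  have [measurable]: "\<phi> \<in> borel_measurable borel"
    using \<phi> by (intro borel_measurable_continuous_onI smooth_continuous schwartz_smooth)
  have "norm (c \<omega> *\<^sub>R \<phi> (r *\<^sub>R X \<omega>)) \<le> 1 * K" if "\<omega> \<in> space M" for \<omega>
    unfolding norm_scaleR
    using c that decay_bound_norm_le[OF K, of "[]"] by (intro mult_mono) (auto simp: weight_def)
  then show ?thesis
    by (intro integrable_const_bound[of _ K] AE_I2) auto
qed

lemma average_has_vector_derivative:
  assumes c: "weight c" and \<phi>: "\<phi> \<in> schwartz"
  shows "(average c \<phi> has_vector_derivative
    (\<Sum>b\<in>Basis. average (\<lambda>\<omega>. c \<omega> * (X \<omega> \<bullet> b)) (partial_deriv b \<phi>) r)) (at r)"
proof -
  let ?g = "\<lambda>t \<omega>. \<Sum>b\<in>Basis. (c \<omega> * (X \<omega> \<bullet> b)) *\<^sub>R partial_deriv b \<phi> (t *\<^sub>R X \<omega>)"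
  obtain K where K: "decay_bound 0 1 \<phi> K" using \<phi> unfolding schwartz_iff by blast
  note int = integrable_average[OF weight_mult_inner[OF c] schwartz_partial_deriv[OF \<phi>]]
  have "((\<lambda>t. LINT \<omega>|M. c \<omega> *\<^sub>R \<phi> (t *\<^sub>R X \<omega>)) has_vector_derivative (LINT \<omega>|M. ?g r \<omega>)) (at r)"
  proof (rule has_vector_derivative_integral)
    show "integrable M (\<lambda>\<omega>. c \<omega> *\<^sub>R \<phi> (t *\<^sub>R X \<omega>))" for t
      using c \<phi> by (rule integrable_average)
    show "?g r \<in> borel_measurable M"
      using int by (intro borel_measurable_sum) auto
    fix t \<omega> assume \<omega>: "\<omega> \<in> space M"
    have "((\<lambda>t. \<phi> (0 + t *\<^sub>R X \<omega>)) has_vector_derivative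
        (\<Sum>b\<in>Basis. (X \<omega> \<bullet> b) *\<^sub>R partial_deriv b \<phi> (0 + t *\<^sub>R X \<omega>))) (at t)"
      by (intro has_derivative_along_line has_derivative_partial_deriv smooth_differentiable schwartz_smooth \<phi>)
    then have "((\<lambda>t. c \<omega> *\<^sub>R \<phi> (t *\<^sub>R X \<omega>)) has_vector_derivative
        c \<omega> *\<^sub>R (\<Sum>b\<in>Basis. (X \<omega> \<bullet> b) *\<^sub>R partial_deriv b \<phi> (t *\<^sub>R X \<omega>))) (at t)"
      by (simp add: bounded_linear.has_vector_derivative[OF bounded_linear_scaleR_right])
    then show "((\<lambda>t. c \<omega> *\<^sub>R \<phi> (t *\<^sub>R X \<omega>)) has_vector_derivative ?g t \<omega>) (at t)"
      by (simp add: scaleR_sum_right)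
    have "norm ((c \<omega> * (X \<omega> \<bullet> b)) *\<^sub>R partial_deriv b \<phi> (t *\<^sub>R X \<omega>)) \<le> 1 * K" if "b \<in> Basis" for b
      unfolding norm_scaleR
      using weight_mult_inner[OF c that] \<omega> that decay_bound_norm_le[OF K, of "[b]"]
      by (intro mult_mono) (auto simp: weight_def)
    then show "norm (?g t \<omega>) \<le> real DIM('a) * K"
      using sum_norm_bound[of Basis "\<lambda>b. (c \<omega> * (X \<omega> \<bullet> b)) *\<^sub>R partial_deriv b \<phi> (t *\<^sub>R X \<omega>)" K] by simp
  qed
  also have "(LINT \<omega>|M. ?g r \<omega>) = (\<Sum>b\<in>Basis. average (\<lambda>\<omega>. c \<omega> * (X \<omega> \<bullet> b)) (partial_deriv b \<phi>) r)"
    using int by (simp add: average_def Bochner_Integration.integral_sum)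
  finally show ?thesis by (simp add: average_def[abs_def])
qed

lemma partial_deriv_average:
  assumes "weight c" "\<phi> \<in> schwartz"
  shows "partial_deriv 1 (average c \<phi>)
    = (\<lambda>r. \<Sum>b\<in>Basis. average (\<lambda>\<omega>. c \<omega> * (X \<omega> \<bullet> b)) (partial_deriv b \<phi>) r)"
proof
  fix r
  show "partial_deriv 1 (average c \<phi>) r = (\<Sum>b\<in>Basis. average (\<lambda>\<omega>. c \<omega> * (X \<omega> \<bullet> b)) (partial_deriv b \<phi>) r)"
    using partial_deriv_eq[OF average_has_vector_derivative[OF assms, of r, unfolded has_vector_derivative_def], of 1]
    by simp
qed

lemma average_differentiable:
  "weight c \<Longrightarrow> \<phi> \<in> schwartz \<Longrightarrow> average c \<phi> differentiable (at r)"
  using average_has_vector_derivative by (meson differentiableI_vector)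

lemma smooth_average:
  assumes "weight c" "\<phi> \<in> schwartz"
  shows "smooth (average c \<phi>)"
  unfolding smooth_def
proof
  fix k
  show "times_cont_diff k (average c \<phi>)"
    using assms
  proof (induction k arbitrary: c \<phi>)
    case 0
    then show ?case
      by (auto intro!: continuous_at_imp_continuous_on differentiable_imp_continuous_within average_differentiable)
  next
    case (Suc k)
    then show ?case
      by (auto simp: partial_deriv_average average_differentiable
          intro!: times_cont_diff_sum Suc.IH weight_mult_inner schwartz_partial_deriv)
  qed
qed

text \<open>\<open>W\<close> is meant as the decay weight at the fixed radius \<open>r\<close>,
  hence a constant under the integral. One differentiation turns an average into
  \<open>DIM('a)\<close> averages with admissible weights; the mass of \<open>M\<close> comes from
  integrating \<open>K\<close>.\<close>

lemma average_bound:
  assumes "weight c" "\<phi> \<in> schwartz" "0 \<le> W"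
    and "\<And>cs \<omega>. set cs \<subseteq> Basis \<Longrightarrow> length cs = n \<Longrightarrow> \<omega> \<in> space M \<Longrightarrow> W * norm (iter_deriv cs \<phi> (r *\<^sub>R X \<omega>)) \<le> K"
  shows "W * norm (iter_deriv (replicate n 1) (average c \<phi>) r) \<le> real DIM('a) ^ n * (K * measure M (space M))"
  using assms
proof (induction n arbitrary: c \<phi>)
  case 0
  have "W * norm (average c \<phi> r) = norm (LINT \<omega>|M. W *\<^sub>R (c \<omega> *\<^sub>R \<phi> (r *\<^sub>R X \<omega>)))"
    using 0(3) by (simp add: average_def integral_scaleR_right del: scaleR_scaleR)
  also have "\<dots> \<le> (LINT \<omega>|M. K)"
  proof (rule order_trans[OF integral_norm_bound integral_mono])
    show "integrable M (\<lambda>\<omega>. norm (W *\<^sub>R (c \<omega> *\<^sub>R \<phi> (r *\<^sub>R X \<omega>))))"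
      using 0 by (intro integrable_norm integrable_scaleR_right integrable_average)
    fix \<omega> assume \<omega>: "\<omega> \<in> space M"
    have "\<bar>c \<omega>\<bar> * (W * norm (\<phi> (r *\<^sub>R X \<omega>))) \<le> 1 * (W * norm (\<phi> (r *\<^sub>R X \<omega>)))"
      using 0 \<omega> by (intro mult_right_mono) (auto simp: weight_def)
    also have "\<dots> \<le> K" using 0(4)[of "[]" \<omega>] \<omega> by simp
    finally show "norm (W *\<^sub>R (c \<omega> *\<^sub>R \<phi> (r *\<^sub>R X \<omega>))) \<le> K"
      using 0(3) by (simp add: abs_mult mult_ac)
  qed simp
  finally show ?case by (simp add: mult_ac)
next
  case (Suc n)
  let ?A = "\<lambda>b. average (\<lambda>\<omega>. c \<omega> * (X \<omega> \<bullet> b)) (partial_deriv b \<phi>)"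
  let ?K = "real DIM('a) ^ n * (K * measure M (space M))"
  have sub: "set (replicate n (1::real)) \<subseteq> Basis" by auto
  \<comment> \<open>The innermost derivative is peeled off because it alone acts on the original
    average; it changes both the function and the weight, and leaves \<open>n\<close> derivatives to
    the induction hypothesis.\<close>
  have "replicate (Suc n) (1::real) = replicate n 1 @ [1]"
    by (simp add: replicate_append_same)
  then have "iter_deriv (replicate (Suc n) 1) (average c \<phi>) = iter_deriv (replicate n 1) (\<lambda>r. \<Sum>b\<in>Basis. ?A b r)"
    using Suc.prems by (simp only: iter_deriv_append iter_deriv_Cons iter_deriv_Nil partial_deriv_average)
  also have "\<dots> = (\<lambda>r. \<Sum>b\<in>Basis. iter_deriv (replicate n 1) (?A b) r)"
    using Suc.prems by (intro iter_deriv_sum sub smooth_average weight_mult_inner schwartz_partial_deriv)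
  finally have "W * norm (iter_deriv (replicate (Suc n) 1) (average c \<phi>) r)
      \<le> W * (\<Sum>b\<in>Basis. norm (iter_deriv (replicate n 1) (?A b) r))"
    using Suc.prems(3) by (simp add: mult_left_mono norm_sum)
  also have "\<dots> \<le> (\<Sum>b\<in>(Basis :: 'a set). ?K)"
    unfolding sum_distrib_left
  proof (intro sum_mono Suc.IH)
    fix b :: 'a assume b: "b \<in> Basis"
    show "weight (\<lambda>\<omega>. c \<omega> * (X \<omega> \<bullet> b))" using Suc.prems(1) b by (rule weight_mult_inner)
    show "partial_deriv b \<phi> \<in> schwartz" using Suc.prems(2) b by (rule schwartz_partial_deriv)
    show "0 \<le> W" by (rule Suc.prems)
    fix cs :: "'a list" and \<omega>
    assume "set cs \<subseteq> Basis" "length cs = n" "\<omega> \<in> space M"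
    then show "W * norm (iter_deriv cs (partial_deriv b \<phi>) (r *\<^sub>R X \<omega>)) \<le> K"
      using Suc.prems(4)[of "cs @ [b]" \<omega>] b by (simp add: iter_deriv_append)
  qed
  finally show ?case by (simp add: mult_ac)
qed

lemma average_diff:
  assumes "weight c" "\<phi> \<in> schwartz" "\<psi> \<in> schwartz"
  shows "average c (\<lambda>x. \<phi> x - \<psi> x) r = average c \<phi> r - average c \<psi> r"
  using assms by (simp add: average_def scaleR_diff_right integrable_average)

end

lemma list_real_Basis: "set bs \<subseteq> (Basis :: real set) \<Longrightarrow> bs = replicate (length bs) 1"
  by (induction bs) auto

section \<open>The spherical mean\<close>

lemma space_sphere_measure: "space (sphere_measure :: 'a::euclidean_space measure) = sphere 0 1"
  and sets_sphere_measure: "sets (sphere_measure :: 'a measure) = sets (restrict_space borel (sphere 0 1))"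
  by (simp_all add: sphere_measure_def space_restrict_space space_scale_measure)

lemma sgn_measurable_ball:
  "(sgn :: 'a::euclidean_space \<Rightarrow> 'a) \<in> measurable (restrict_space lborel (ball 0 1 - {0})) (restrict_space borel (sphere 0 1))"
  by (rule measurable_restrict_space3) (auto simp: norm_sgn sgn_div_norm[abs_def])

lemma unit_sphere_area_pos: "0 < d \<Longrightarrow> 0 < unit_sphere_area d"
  by (simp add: unit_sphere_area_def Gamma_real_pos)

lemma measure_sphere_measure:
  "measure (sphere_measure :: 'a::euclidean_space measure) (sphere 0 1) = unit_sphere_area DIM('a)"
  using unit_sphere_area_pos[of "DIM('a)"] by (simp add: measure_def emeasure_sphere_measure)

lemma lborel_distr_uminus_euclidean: "distr lborel borel uminus = (lborel :: 'a::euclidean_space measure)"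
  using lborel_affine[of "-1" "0::'a"] by (simp add: density_1)

text \<open>\<open>sgn\<close> commutes with negation and the punctured ball is symmetric, so
  reflection invariance is inherited from Lebesgue measure. It is the source of the evenness of
  spherical means.\<close>

lemma distr_sphere_measure_uminus:
  "distr sphere_measure sphere_measure uminus = (sphere_measure :: 'a::euclidean_space measure)"
proof (rule measure_eqI)
  let ?S = "sphere_measure :: 'a measure" and ?B = "ball 0 1 - {0::'a}"
  have um: "uminus \<in> measurable ?S ?S"
    unfolding measurable_cong_sets[OF sets_sphere_measure sets_sphere_measure]
    by (rule measurable_restrict_space3) auto
  have em: "emeasure ?S A = of_nat DIM('a) * emeasure lborel (sgn -` A \<inter> ?B)" if "A \<in> sets ?S" for A
  proof -
    have "emeasure (restrict_space lborel ?B) (sgn -` A \<inter> ?B) = emeasure lborel (sgn -` A \<inter> ?B)"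
      by (rule emeasure_restrict_space) auto
    then show ?thesis
      using that unfolding sphere_measure_def
      by (simp add: emeasure_distr[OF sgn_measurable_ball] space_restrict_space)
  qed
  fix A assume "A \<in> sets (distr ?S ?S uminus)"
  then have A: "A \<in> sets ?S" by simp
  have mA: "uminus -` A \<inter> space ?S \<in> sets ?S"
    using um A by (rule measurable_sets)
  have "sgn -` A \<inter> ?B \<in> sets (restrict_space lborel ?B)"
    using measurable_sets[OF sgn_measurable_ball, of A] A
    by (simp add: sets_sphere_measure space_restrict_space)
  then have sA: "sgn -` A \<inter> ?B \<in> sets borel"
    by (subst (asm) sets_restrict_space_iff) auto
  have "emeasure (distr ?S ?S uminus) A = emeasure ?S (uminus -` A \<inter> space ?S)"
    using um A by (rule emeasure_distr)
  also have "\<dots> = of_nat DIM('a) * emeasure lborel (sgn -` (uminus -` A \<inter> space ?S) \<inter> ?B)"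
    using mA by (rule em)
  also have "sgn -` (uminus -` A \<inter> space ?S) \<inter> ?B = uminus -` (sgn -` A \<inter> ?B)"
    by (auto simp: space_sphere_measure norm_sgn sgn_minus)
  also have "emeasure lborel (uminus -` (sgn -` A \<inter> ?B)) = emeasure (distr lborel borel uminus) (sgn -` A \<inter> ?B)"
    using sA by (simp add: emeasure_distr)
  also have "\<dots> = emeasure lborel (sgn -` A \<inter> ?B)"
    by (simp add: lborel_distr_uminus_euclidean)
  finally show "emeasure (distr ?S ?S uminus) A = emeasure ?S A"
    using em[OF A] by simp
qed simp

interpretation sphere: unit_bounded "sphere_measure :: 'a::euclidean_space measure" "\<lambda>\<xi>. \<xi>"
proof (intro unit_bounded.intro unit_bounded_axioms.intro finite_measureI)
  show "emeasure (sphere_measure :: 'a measure) (space sphere_measure) \<noteq> \<infinity>"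
    by (simp add: space_sphere_measure emeasure_sphere_measure)
  show "(\<lambda>\<xi>. \<xi>) \<in> borel_measurable (sphere_measure :: 'a measure)"
    unfolding measurable_cong_sets[OF sets_sphere_measure refl]
    by (rule measurable_restrict_space1) simp
qed (simp add: space_sphere_measure)

lemma averaging_op_eq:
  "averaging_op \<phi> r = (1 / unit_sphere_area DIM('a)) *\<^sub>R sphere.average (\<lambda>_. 1) \<phi> r"
  for \<phi> :: "'a::euclidean_space \<Rightarrow> complex"
  by (simp add: averaging_op_def sphere.average_def)

lemma smooth_averaging_op:
  "\<phi> \<in> schwartz \<Longrightarrow> smooth (averaging_op \<phi>)"
  unfolding averaging_op_eq[abs_def]
  by (intro smooth_scaleR smooth_const sphere.smooth_average sphere.weight_one)

lemma decay_bound_averaging_op: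
  fixes \<phi> :: "'a::euclidean_space \<Rightarrow> complex"
  assumes \<phi>: "\<phi> \<in> schwartz" and K: "decay_bound N n \<phi> K"
  shows "decay_bound N n (averaging_op \<phi>) (real DIM('a) ^ n * K)"
proof (rule decay_boundI)
  fix bs :: "real list" and r :: real
  assume bs: "set bs \<subseteq> Basis" "length bs \<le> n"
  let ?\<omega> = "unit_sphere_area DIM('a)" and ?A = "sphere.average (\<lambda>_::'a. 1) \<phi>"
  have \<omega>: "?\<omega> > 0" by (simp add: unit_sphere_area_pos)
  have "iter_deriv bs (averaging_op \<phi>) r = (1 / ?\<omega>) *\<^sub>R iter_deriv bs ?A r"
    unfolding averaging_op_eq[abs_def]
    using iter_deriv_bounded_linear[OF bounded_linear_scaleR_right
        sphere.smooth_average[OF sphere.weight_one \<phi>] bs(1)] by (rule fun_cong)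
  then have "(1 + norm r) ^ N * norm (iter_deriv bs (averaging_op \<phi>) r)
      = (1 / ?\<omega>) * ((1 + norm r) ^ N * norm (iter_deriv bs ?A r))"
    using \<omega> by simp
  \<comment> \<open>The total mass of the sphere, which enters through
    \<open>sphere.average_bound\<close>, cancels against the normalising factor.\<close>
  also have "\<dots> \<le> (1 / ?\<omega>) * (real DIM('a) ^ length bs * (K * ?\<omega>))"
  proof (intro mult_left_mono)
    have "(1 + norm r) ^ N * norm (iter_deriv (replicate (length bs) 1) ?A r)
        \<le> real DIM('a) ^ length bs * (K * measure (sphere_measure :: 'a measure) (space sphere_measure))"
    proof (rule sphere.average_bound[OF sphere.weight_one \<phi>])
      fix cs :: "'a list" and \<xi> :: 'a
      assume "set cs \<subseteq> Basis" "length cs = length bs" "\<xi> \<in> space sphere_measure"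
      then show "(1 + norm r) ^ N * norm (iter_deriv cs \<phi> (r *\<^sub>R \<xi>)) \<le> K"
        using decay_boundD[OF K, of cs "r *\<^sub>R \<xi>"] bs(2) by (simp add: space_sphere_measure)
    qed simp
    then show "(1 + norm r) ^ N * norm (iter_deriv bs ?A r) \<le> real DIM('a) ^ length bs * (K * ?\<omega>)"
      using list_real_Basis[OF bs(1)] by (simp add: space_sphere_measure measure_sphere_measure)
  qed (use \<omega> in simp)
  also have "\<dots> = real DIM('a) ^ length bs * K"
    using \<omega> by simp
  \<comment> \<open>Lists shorter than \<open>n\<close> give smaller powers, because the dimension
    is at least 1 and \<open>K\<close> is nonnegative.\<close>
  also have "\<dots> \<le> real DIM('a) ^ n * K"
  proof (intro mult_right_mono power_increasing)
    show "1 \<le> real DIM('a)" using DIM_positive[where 'a = 'a] by linarith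
  qed (use bs decay_bound_nonneg[OF K] in auto)
  finally show "(1 + norm r) ^ N * norm (iter_deriv bs (averaging_op \<phi>) r) \<le> real DIM('a) ^ n * K" .
qed

lemma averaging_op_minus:
  fixes \<phi> :: "'a::euclidean_space \<Rightarrow> complex"
  assumes "\<phi> \<in> schwartz"
  shows "averaging_op \<phi> (- r) = averaging_op \<phi> r"
proof -
  have um: "uminus \<in> measurable (sphere_measure :: 'a measure) sphere_measure"
    unfolding measurable_cong_sets[OF sets_sphere_measure sets_sphere_measure]
    by (rule measurable_restrict_space3) auto
  have "(LINT \<xi>|sphere_measure. \<phi> (r *\<^sub>R \<xi>)) = (LINT \<xi>|distr sphere_measure sphere_measure uminus. \<phi> (r *\<^sub>R \<xi>))"
    by (simp add: distr_sphere_measure_uminus)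
  also have "\<dots> = (LINT \<xi>|sphere_measure. \<phi> (r *\<^sub>R (- \<xi>)))"
    using sphere.integrable_average[OF sphere.weight_one assms, of r] by (intro integral_distr um) auto
  finally show ?thesis by (simp add: averaging_op_def)
qed

lemma schwartz_rad_real_iff:
  fixes f :: "real \<Rightarrow> complex"
  shows "f \<in> schwartz_rad \<longleftrightarrow> f \<in> schwartz \<and> (\<forall>r. f (- r) = f r)"
proof -
  have "orthogonal_transformation (uminus :: real \<Rightarrow> real)"
    by (simp add: orthogonal_transformation_def linear_iff)
  \<comment> \<open>The sign may depend on \<open>r\<close>, since invariance is tested at one point
    at a time.\<close>
  moreover have "Q r = r \<or> Q r = - r" if "orthogonal_transformation Q" for Q :: "real \<Rightarrow> real" and r
    using orthogonal_transformation_norm[OF that, of r] by (simp add: abs_eq_iff)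
  ultimately have "(\<forall>Q. orthogonal_transformation Q \<longrightarrow> f \<circ> Q = f) \<longleftrightarrow> (\<forall>r. f (- r) = f r)"
    unfolding fun_eq_iff o_def by metis
  then show ?thesis by (simp add: schwartz_rad_def)
qed

lemma averaging_op_schwartz_rad:
  "\<phi> \<in> schwartz \<Longrightarrow> averaging_op \<phi> \<in> schwartz_rad"
  unfolding schwartz_rad_real_iff
  by (simp add: averaging_op_minus) (meson schwartz_iff smooth_averaging_op decay_bound_averaging_op)

lemma averaging_op_diff:
  assumes "\<phi> \<in> schwartz" "\<psi> \<in> schwartz"
  shows "averaging_op (\<lambda>x. \<phi> x - \<psi> x) = (\<lambda>r. averaging_op \<phi> r - averaging_op \<psi> r)"
  using assms by (simp add: averaging_op_eq fun_eq_iff sphere.average_diff sphere.weight_one scaleR_diff_right)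

section \<open>Radial functions\<close>

interpretation unit_interval: unit_bounded "restrict_space lborel {0..1::real}" "\<lambda>s. s"
proof (intro unit_bounded.intro unit_bounded_axioms.intro finite_measureI)
  show "emeasure (restrict_space lborel {0..1::real}) (space (restrict_space lborel {0..1})) \<noteq> \<infinity>"
    by (simp add: space_restrict_space emeasure_restrict_space)
  show "(\<lambda>s. s) \<in> borel_measurable (restrict_space lborel {0..1::real})"
    by (rule measurable_restrict_space1) simp
qed (simp add: space_restrict_space)

text \<open>For even \<open>g\<close> this is \<open>g' r / r\<close>, extended smoothly across \<open>r = 0\<close>.\<close>

definition radial_deriv :: "(real \<Rightarrow> complex) \<Rightarrow> real \<Rightarrow> complex" where
  "radial_deriv g = unit_interval.average (\<lambda>_. 1) (partial_deriv 1 (partial_deriv 1 g))"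

section \<open>Hadamard's quotient of an even function\<close>

lemma partial_deriv_reflect:
  fixes f :: "real \<Rightarrow> 'b::real_normed_vector"
  assumes "f differentiable (at (- x))"
  shows "partial_deriv 1 (\<lambda>x. f (- x)) x = - partial_deriv 1 f (- x)"
proof -
  obtain D where D: "(f has_derivative D) (at (- x))"
    using assms by (auto simp: differentiable_def)
  have "((\<lambda>x. - x) has_derivative (\<lambda>h. - h)) (at x)"
    by (auto intro!: derivative_eq_intros)
  from has_derivative_compose[OF this D]
  have "partial_deriv 1 (\<lambda>x. f (- x)) x = D (- 1)"
    by (rule partial_deriv_eq)
  also have "\<dots> = - D 1"
    using has_derivative_linear[OF D] by (rule linear_neg)
  finally show ?thesis by (simp add: partial_deriv_eq[OF D])
qed

lemma
  fixes g :: "real \<Rightarrow> complex"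
  assumes "g \<in> schwartz_rad"
  shows partial_deriv_odd: "partial_deriv 1 g (- r) = - partial_deriv 1 g r"
    and second_partial_deriv_even: "partial_deriv 1 (partial_deriv 1 g) (- r) = partial_deriv 1 (partial_deriv 1 g) r"
proof -
  let ?g1 = "partial_deriv 1 g"
  have g: "smooth g"
    using assms by (simp add: schwartz_rad_def schwartz_smooth)
  have even: "g (- r) = g r" for r
    using assms by (simp add: schwartz_rad_real_iff)
  have g1: "smooth ?g1" using g by (simp add: smooth_partial_deriv)
  show odd: "?g1 (- r) = - ?g1 r" for r
    using partial_deriv_reflect[OF smooth_differentiable[OF g], of r] by (simp add: even)
  have "partial_deriv 1 (\<lambda>x. - ?g1 x) r = - partial_deriv 1 ?g1 r"
    using partial_deriv_bounded_linear[OF bounded_linear_minus[OF bounded_linear_ident], of ?g1 1]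
      smooth_differentiable[OF g1] by (simp add: fun_eq_iff)
  then show "partial_deriv 1 ?g1 (- r) = partial_deriv 1 ?g1 r"
    using partial_deriv_reflect[OF smooth_differentiable[OF g1], of r] by (simp add: odd)
qed

lemma second_partial_deriv_schwartz:
  "g \<in> schwartz_rad \<Longrightarrow> partial_deriv 1 (partial_deriv (1::real) g) \<in> schwartz"
  by (simp add: schwartz_rad_def schwartz_partial_deriv)

lemma smooth_radial_deriv: "g \<in> schwartz_rad \<Longrightarrow> smooth (radial_deriv g)"
  unfolding radial_deriv_def
  by (intro unit_interval.smooth_average unit_interval.weight_one second_partial_deriv_schwartz)

lemma radial_deriv_minus: "g \<in> schwartz_rad \<Longrightarrow> radial_deriv g (- r) = radial_deriv g r"
  by (simp add: radial_deriv_def unit_interval.average_def second_partial_deriv_even)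

text \<open>The fundamental theorem is applied to s |-> g'(r s) on the unit interval, with g'(0) = 0
  by oddness. The factor is written \<open>r \<bullet> 1\<close> to match the Leibniz rule for a
  coordinate.\<close>

lemma partial_deriv_eq_radial_deriv:
  assumes g: "g \<in> schwartz_rad"
  shows "partial_deriv 1 g = (\<lambda>r. (r \<bullet> 1) *\<^sub>R radial_deriv g r)"
proof
  fix r :: real
  let ?g1 = "partial_deriv 1 g" and ?g2 = "partial_deriv 1 (partial_deriv 1 g)"
  have g1: "smooth ?g1" and g2: "continuous_on UNIV ?g2"
    using g by (simp_all add: schwartz_rad_def schwartz_smooth smooth_partial_deriv smooth_continuous)
  have "?g1 0 = 0"
    using partial_deriv_odd[OF g, of 0] by simp
  moreover have "(LINT s|lborel. indicator {0..1} s *\<^sub>R (r *\<^sub>R ?g2 (r *\<^sub>R s))) = ?g1 (r *\<^sub>R 1) - ?g1 (r *\<^sub>R 0)"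
  proof (rule integral_FTC_Icc)
    fix s :: real
    have "((\<lambda>s. ?g1 (0 + s *\<^sub>R r)) has_vector_derivative
        (\<Sum>b\<in>Basis. (r \<bullet> b) *\<^sub>R partial_deriv b ?g1 (0 + s *\<^sub>R r))) (at s within {0..1})"
      by (intro has_derivative_along_line has_derivative_partial_deriv smooth_differentiable g1)
    then show "((\<lambda>s. ?g1 (r *\<^sub>R s)) has_vector_derivative r *\<^sub>R ?g2 (r *\<^sub>R s)) (at s within {0..1})"
      by (simp add: mult.commute)
  next
    show "continuous_on {0..1} (\<lambda>s. r *\<^sub>R ?g2 (r *\<^sub>R s))"
      by (intro continuous_intros continuous_on_compose2[OF g2]) auto
  qed simp
  moreover have "r *\<^sub>R radial_deriv g r = (LINT s|lborel. indicator {0..1} s *\<^sub>R (r *\<^sub>R ?g2 (r *\<^sub>R s)))"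
    unfolding radial_deriv_def unit_interval.average_def
    by (simp add: integral_restrict_space scaleR_left_commute[of _ r] integral_scaleR_right del: scaleR_scaleR)
  ultimately show "?g1 r = (r \<bullet> 1) *\<^sub>R radial_deriv g r" by simp
qed

text \<open>For |r| > 1 the Leibniz identity is solved for the top derivative, and the derivative of
  order \<open>j - 1\<close> enters through \<open>L\<close>. For |r| at most 1 the average is
  bounded by \<open>K\<close> and the weight by \<open>2 ^ N\<close>.\<close>

lemma radial_deriv_decay_step:
  assumes g: "g \<in> schwartz_rad" and K: "decay_bound N (j + 2) g K"
    and L: "0 \<le> L" "j > 0 \<Longrightarrow> (1 + norm r) ^ N * norm (iter_deriv (replicate (j - 1) 1) (radial_deriv g) r) \<le> L"
  shows "(1 + norm r) ^ N * norm (iter_deriv (replicate j 1) (radial_deriv g) r) \<le> 2 ^ N * K + K + real j * L"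
    (is "?w * norm (?D j) \<le> _")
proof -
  have K0: "0 \<le> K" using K by (rule decay_bound_nonneg)
  show ?thesis
  proof (cases "norm r \<le> 1")
    case True
    have "1 * norm (?D j) \<le> real DIM(real) ^ j * (K * measure (restrict_space lborel {0..1::real}) (space (restrict_space lborel {0..1})))"
      unfolding radial_deriv_def
    proof (rule unit_interval.average_bound)
      fix cs :: "real list" and s :: real
      assume "set cs \<subseteq> Basis" "length cs = j"
      then show "1 * norm (iter_deriv cs (partial_deriv 1 (partial_deriv 1 g)) (r *\<^sub>R s)) \<le> K"
        using decay_bound_norm_le[OF K, of "cs @ [1, 1]"] by (simp add: iter_deriv_append)
    qed (use g in \<open>auto simp: unit_interval.weight_one second_partial_deriv_schwartz\<close>)
    then have "norm (?D j) \<le> K"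
      by (simp add: space_restrict_space measure_restrict_space)
    moreover have "?w \<le> 2 ^ N" using True by (intro power_mono) auto
    ultimately have "?w * norm (?D j) \<le> 2 ^ N * K" by (intro mult_mono) auto
    then show ?thesis using K0 L(1) by (simp add: add_increasing2)
  next
    case False
    have "iter_deriv (replicate j 1 @ [1]) g = iter_deriv (replicate j 1) (\<lambda>r. (r \<bullet> 1) *\<^sub>R radial_deriv g r)"
      by (simp add: iter_deriv_append partial_deriv_eq_radial_deriv[OF g])
    also have "\<dots> = (\<lambda>r. (r \<bullet> 1) *\<^sub>R iter_deriv (replicate j 1) (radial_deriv g) r
        + real (count_list (replicate j (1::real)) 1) *\<^sub>R iter_deriv (remove1 1 (replicate j 1)) (radial_deriv g) r)"
      by (intro iter_deriv_inner_scaleR smooth_radial_deriv g) auto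
    also have "count_list (replicate j (1::real)) 1 = j"
      by (induction j) auto
    \<comment> \<open>At \<open>j = 0\<close> truncated subtraction yields the empty list, in
      agreement with \<open>remove1\<close>; the coefficient \<open>real j\<close> then annihilates
      the term.\<close>
    also have "remove1 1 (replicate j (1::real)) = replicate (j - 1) 1"
      by (cases j) auto
    finally have "r *\<^sub>R ?D j = iter_deriv (replicate j 1 @ [1]) g r - real j *\<^sub>R ?D (j - 1)"
      by simp
    then have "\<bar>r\<bar> * norm (?D j) \<le> norm (iter_deriv (replicate j 1 @ [1]) g r) + real j * norm (?D (j - 1))"
      by (metis norm_triangle_ineq4 norm_scaleR abs_of_nat)
    moreover have "norm (?D j) \<le> \<bar>r\<bar> * norm (?D j)"
      using False by (simp add: mult_le_cancel_right1)
    ultimately have "?w * norm (?D j) \<le> ?w * (norm (iter_deriv (replicate j 1 @ [1]) g r) + real j * norm (?D (j - 1)))"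
      by (intro mult_left_mono) auto
    also have "\<dots> = ?w * norm (iter_deriv (replicate j 1 @ [1]) g r) + real j * (?w * norm (?D (j - 1)))"
      by (simp only: distrib_left mult.left_commute)
    also have "\<dots> \<le> K + real j * L"
    proof (rule add_mono)
      show "?w * norm (iter_deriv (replicate j 1 @ [1]) g r) \<le> K"
        by (rule decay_boundD[OF K]) auto
      show "real j * (?w * norm (?D (j - 1))) \<le> real j * L"
        using L(2) by (cases "j = 0") auto
    qed
    also have "\<dots> \<le> 2 ^ N * K + (K + real j * L)"
      using K0 by simp
    finally show ?thesis by (simp only: add.assoc)
  qed
qed

text \<open>The two extra orders pay for the second derivative under the average. The induction on
  \<open>n\<close> feeds the bound for one order into the next.\<close>

lemma decay_bound_radial_deriv:
  "\<exists>C\<ge>0. \<forall>g\<in>schwartz_rad. \<forall>K. decay_bound N (n + 2) g K \<longrightarrow> decay_bound N n (radial_deriv g) (C * K)"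
proof (induction n)
  case 0
  have "decay_bound N 0 (radial_deriv g) ((2 ^ N + 1) * K)"
    if "g \<in> schwartz_rad" "decay_bound N (0 + 2) g K" for g K
  proof (rule decay_boundI)
    fix bs :: "real list" and r :: real
    assume "length bs \<le> 0"
    then show "(1 + norm r) ^ N * norm (iter_deriv bs (radial_deriv g) r) \<le> (2 ^ N + 1) * K"
      using radial_deriv_decay_step[OF that, of 0 r] by (simp add: distrib_right)
  qed
  then show ?case by (intro exI[of _ "2 ^ N + 1"]) simp
next
  case (Suc n)
  then obtain C where C: "C \<ge> 0"
    and IH: "\<And>g K. g \<in> schwartz_rad \<Longrightarrow> decay_bound N (n + 2) g K \<Longrightarrow> decay_bound N n (radial_deriv g) (C * K)"
    by blast
  \<comment> \<open>\<open>2 ^ N\<close> stems from |r| at most 1, the 1 from the derivative of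
    \<open>g\<close> for |r| > 1, and the last term from at most \<open>Suc n\<close> copies of the
    lower-order derivative.\<close>
  let ?C = "2 ^ N + 1 + real (Suc n) * C"
  have "decay_bound N (Suc n) (radial_deriv g) (?C * K)"
    if g: "g \<in> schwartz_rad" and K: "decay_bound N (Suc n + 2) g K" for g K
  proof (rule decay_boundI)
    fix bs :: "real list" and r :: real
    assume bs: "set bs \<subseteq> Basis" "length bs \<le> Suc n"
    let ?j = "length bs"
    have K0: "0 \<le> K" using K by (rule decay_bound_nonneg)
    have "decay_bound N n (radial_deriv g) (C * K)"
      using K by (intro IH g decay_bound_mono[OF K]) auto
    then have "(1 + norm r) ^ N * norm (iter_deriv (replicate (?j - 1) 1) (radial_deriv g) r) \<le> C * K"
      using bs by (intro decay_boundD) auto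
    moreover have "decay_bound N (?j + 2) g K"
      using bs by (intro decay_bound_mono[OF K]) auto
    ultimately have "(1 + norm r) ^ N * norm (iter_deriv (replicate ?j 1) (radial_deriv g) r)
        \<le> 2 ^ N * K + K + real ?j * (C * K)"
      using C K0 by (intro radial_deriv_decay_step g) auto
    also have "\<dots> \<le> 2 ^ N * K + K + real (Suc n) * (C * K)"
      using bs C K0 by (intro add_left_mono mult_right_mono) auto
    also have "\<dots> = ?C * K" by (simp only: distrib_right mult.assoc mult_1_left)
    finally show "(1 + norm r) ^ N * norm (iter_deriv bs (radial_deriv g) r) \<le> ?C * K"
      using list_real_Basis[OF bs(1)] by simp
  qed
  then show ?case using C by (intro exI[of _ ?C]) simp
qed

text \<open>Closure of the class under the quotient lets the gradient formula be applied again to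
  its own radial factor.\<close>

lemma radial_deriv_schwartz_rad:
  assumes g: "g \<in> schwartz_rad"
  shows "radial_deriv g \<in> schwartz_rad"
proof -
  have "\<exists>K. decay_bound N n (radial_deriv g) K" for N n
    using decay_bound_radial_deriv[of N n] g unfolding schwartz_rad_def schwartz_iff by blast
  then show ?thesis
    using g by (simp add: schwartz_rad_real_iff schwartz_iff smooth_radial_deriv radial_deriv_minus)
qed

section \<open>Derivatives and decay of radial extensions\<close>

lemma has_derivative_rotation_op:
  fixes x :: "'a::euclidean_space"
  assumes g: "g \<in> schwartz_rad"
  shows "(rotation_op g has_derivative (\<lambda>v. (x \<bullet> v) *\<^sub>R radial_deriv g (norm x))) (at x)"
proof -
  have g': "(g has_derivative (\<lambda>h. (h * t) *\<^sub>R radial_deriv g t)) (at t)" for t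
  proof -
    have "g differentiable (at t)"
      using g by (simp add: schwartz_rad_def schwartz_smooth smooth_differentiable)
    from has_derivative_partial_deriv[OF this] show ?thesis
      by (simp add: partial_deriv_eq_radial_deriv[OF g])
  qed
  show ?thesis
  proof (cases "x = 0")
    case False
    from has_derivative_compose[OF has_derivative_norm[OF False] g']
    have "((\<lambda>x. g (norm x)) has_derivative (\<lambda>v. ((sgn x \<bullet> v) * norm x) *\<^sub>R radial_deriv g (norm x))) (at x)"
      by (simp add: inner_commute)
    \<comment> \<open>The factor |x| supplied by g' cancels the singularity of the direction field
      x/|x|.\<close>
    moreover have "(sgn x \<bullet> v) * norm x = x \<bullet> v" for v
      using False by (simp add: sgn_div_norm)
    ultimately show ?thesis by (simp add: rotation_op_def o_def)
  next
    case True
    \<comment> \<open>At the origin the claimed derivative is zero, and g'(0) = 0 means g(h) - g(0)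
      = o(h); it remains to substitute the norm of a vector for h.\<close>
    have "((\<lambda>h. norm (g (0 + h) - g 0 - 0) / norm h) \<longlongrightarrow> 0) (at 0)"
      using g'[of 0] by (simp add: has_derivative_at)
    moreover have "filterlim norm (at 0) (at (0::'a))"
      by (auto simp: filterlim_at eventually_at_filter intro!: tendsto_eq_intros)
    ultimately have "((\<lambda>h::'a. norm (g (0 + norm h) - g 0 - 0) / norm (norm h)) \<longlongrightarrow> 0) (at 0)"
      by (rule filterlim_compose)
    then show ?thesis
      using True by (simp add: has_derivative_at rotation_op_def)
  qed
qed

lemma rotation_op_differentiable: "g \<in> schwartz_rad \<Longrightarrow> rotation_op g differentiable (at x)"
  using has_derivative_rotation_op unfolding differentiable_def by blast

lemma partial_deriv_rotation_op:
  "g \<in> schwartz_rad \<Longrightarrow> partial_deriv b (rotation_op g) = (\<lambda>x. (x \<bullet> b) *\<^sub>R rotation_op (radial_deriv g) x)"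
  using partial_deriv_eq[OF has_derivative_rotation_op] by (auto simp: rotation_op_def)

lemma smooth_rotation_op:
  assumes "g \<in> schwartz_rad"
  shows "smooth (rotation_op g :: 'a::euclidean_space \<Rightarrow> complex)"
  unfolding smooth_def
proof
  fix k
  show "times_cont_diff k (rotation_op g :: 'a \<Rightarrow> complex)"
    using assms
  proof (induction k arbitrary: g)
    case 0
    then show ?case
      by (auto intro!: continuous_at_imp_continuous_on differentiable_imp_continuous_within rotation_op_differentiable)
  next
    case (Suc k)
    then show ?case
      by (auto simp: partial_deriv_rotation_op rotation_op_differentiable
          intro!: times_cont_diff_scaleR times_cont_diff_inner Suc.IH radial_deriv_schwartz_rad)
  qed
qed

text \<open>
  Every derivative of \<open>rotation_op g\<close> costs two derivatives of \<open>g\<close> (through \<open>radial_deriv\<close>)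
  and one power of the weight (through the factor \<open>x \<bullet> b\<close>).
\<close>

lemma decay_bound_rotation_op:
  "\<exists>C\<ge>0. \<forall>g\<in>schwartz_rad. \<forall>K. decay_bound (N + n) (2 * n) g K
     \<longrightarrow> decay_bound N n (rotation_op g :: 'a::euclidean_space \<Rightarrow> complex) (C * K)"
proof (induction n arbitrary: N)
  case 0
  have "decay_bound N 0 (rotation_op g :: 'a \<Rightarrow> complex) (1 * K)" if "decay_bound (N + 0) (2 * 0) g K" for g K
    by (rule decay_boundI) (use decay_boundD[OF that, of "[]" "norm _"] in \<open>simp add: rotation_op_def\<close>)
  then show ?case by (intro exI[of _ 1]) simp
next
  case (Suc n)
  \<comment> \<open>The induction leaves \<open>N\<close> arbitrary so that the hypothesis is
    available with one more power, to be spent on the coordinate.\<close>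
  obtain C1 where C1: "C1 \<ge> 0" "\<And>g K. g \<in> schwartz_rad \<Longrightarrow> decay_bound (Suc N + n) (2 * n) g K
      \<Longrightarrow> decay_bound (Suc N) n (rotation_op g :: 'a \<Rightarrow> complex) (C1 * K)"
    using Suc.IH[of "Suc N"] by blast
  obtain C2 where C2: "C2 \<ge> 0" "\<And>g K. g \<in> schwartz_rad \<Longrightarrow> decay_bound (Suc N + n) (2 * n + 2) g K
      \<Longrightarrow> decay_bound (Suc N + n) (2 * n) (radial_deriv g) (C2 * K)"
    using decay_bound_radial_deriv[of "Suc N + n" "2 * n"] by blast
  \<comment> \<open>The 1 covers the empty list; the product collects the Leibniz factor, the
    constant of the induction hypothesis and that of the quotient.\<close>
  let ?C = "1 + (1 + real n) * (C1 * C2)"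
  have "decay_bound N (Suc n) (rotation_op g :: 'a \<Rightarrow> complex) (?C * K)"
    if g: "g \<in> schwartz_rad" and K: "decay_bound (N + Suc n) (2 * Suc n) g K" for g K
  proof (rule decay_boundI)
    fix bs :: "'a list" and x :: 'a
    assume bs: "set bs \<subseteq> Basis" "length bs \<le> Suc n"
    have K0: "0 \<le> K" using K by (rule decay_bound_nonneg)
    have nonneg: "0 \<le> (1 + real n) * (C1 * (C2 * K))"
      using C1 C2 K0 by simp
    have C_eq: "?C * K = K + (1 + real n) * (C1 * (C2 * K))"
      by (simp only: distrib_right mult.assoc mult_1_left)
    show "(1 + norm x) ^ N * norm (iter_deriv bs (rotation_op g) x) \<le> ?C * K"
    \<comment> \<open>The last entry acts first, so it is the one that meets
      \<open>rotation_op g\<close> itself and can be replaced by the gradient formula.\<close>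
    proof (cases bs rule: rev_cases)
      case Nil
      have "decay_bound N 0 g K" by (rule decay_bound_mono[OF K]) auto
      then show ?thesis
        using decay_boundD[of N 0 g K "[]" "norm x"] Nil nonneg unfolding C_eq
        by (simp add: rotation_op_def)
    next
      case (snoc cs b)
      have b: "b \<in> Basis" and cs: "set cs \<subseteq> Basis" "length cs \<le> n"
        using bs snoc by auto
      have "decay_bound (Suc N + n) (2 * n) (radial_deriv g) (C2 * K)"
        using K by (intro C2(2) g) simp
      then have "decay_bound (Suc N) n (rotation_op (radial_deriv g) :: 'a \<Rightarrow> complex) (C1 * (C2 * K))"
        by (intro C1(2) radial_deriv_schwartz_rad g)
      then have "decay_bound N n (partial_deriv b (rotation_op g)) ((1 + real n) * (C1 * (C2 * K)))"
        unfolding partial_deriv_rotation_op[OF g]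
        by (intro decay_bound_inner_scaleR smooth_rotation_op radial_deriv_schwartz_rad g b)
      from decay_boundD[OF this cs, of x] show ?thesis
        using K0 unfolding C_eq snoc by (simp add: iter_deriv_append)
    qed
  qed
  then show ?case using C1(1) C2(1) by (intro exI[of _ ?C]) simp
qed

lemma rotation_op_schwartz_rad:
  assumes g: "g \<in> schwartz_rad"
  shows "rotation_op g \<in> schwartz_rad"
proof -
  have "\<exists>K. decay_bound N n (rotation_op g) K" for N n
    using decay_bound_rotation_op[of N n] g unfolding schwartz_rad_def schwartz_iff by blast
  then show ?thesis
    using smooth_rotation_op[OF g]
    by (auto simp: schwartz_rad_def schwartz_iff rotation_op_def orthogonal_transformation_norm)
qed

section \<open>Norm estimates and continuity of the two operators\<close>

lemma schwartz_norm_rotation_op: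
  "\<exists>C>0. \<forall>g\<in>schwartz_rad.
     schwartz_norm m (rotation_op g :: 'a::euclidean_space \<Rightarrow> complex) \<le> ennreal C * schwartz_norm (4 * m) g"
proof -
  obtain C where C: "C \<ge> 0" "\<And>g K. g \<in> schwartz_rad \<Longrightarrow> decay_bound (m + m) (2 * m) g K
      \<Longrightarrow> decay_bound m m (rotation_op g :: 'a \<Rightarrow> complex) (C * K)"
    using decay_bound_rotation_op[of m m] by blast
  \<comment> \<open>\<open>C\<close> may be zero; adding 1 secures strict positivity.\<close>
  have "schwartz_norm m (rotation_op g :: 'a \<Rightarrow> complex) \<le> ennreal (C + 1) * schwartz_norm (4 * m) g"
    if g: "g \<in> schwartz_rad" for g
  proof (rule schwartz_norm_bound)
    show "g \<in> schwartz" using g by (simp add: schwartz_rad_def)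
    fix K assume K: "decay_bound (4 * m) (4 * m) g K"
    \<comment> \<open>The estimate consumes weight 2m and order 2m, both covered by the index
      4m.\<close>
    have "decay_bound m m (rotation_op g :: 'a \<Rightarrow> complex) (C * K)"
      by (rule C(2)[OF g decay_bound_mono[OF K]]) auto
    then show "decay_bound m m (rotation_op g :: 'a \<Rightarrow> complex) ((C + 1) * K)"
      by (rule decay_bound_mono) (use decay_bound_nonneg[OF K] in \<open>auto simp: distrib_right\<close>)
  qed (use C in simp)
  then show ?thesis using C(1) by (intro exI[of _ "C + 1"]) auto
qed

lemma schwartz_norm_averaging_op:
  fixes \<phi> :: "'a::euclidean_space \<Rightarrow> complex"
  assumes "\<phi> \<in> schwartz"
  shows "schwartz_norm m (averaging_op \<phi>) \<le> ennreal (real DIM('a) ^ m) * schwartz_norm m \<phi>"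
  using assms by (intro schwartz_norm_bound decay_bound_averaging_op) auto

theorem theorem4p1:
  shows
    "((\<forall>\<psi>\<in>schwartz_rad. (rotation_op \<psi> :: real ^ 'n \<Rightarrow> complex) \<in> schwartz_rad)
      \<and> (\<forall>\<psi>\<in>schwartz_rad. \<forall>\<eta>\<in>schwartz_rad. \<forall>a b.
           (rotation_op (\<lambda>r. a * \<psi> r + b * \<eta> r) :: real ^ 'n \<Rightarrow> complex)
             = (\<lambda>x. a * rotation_op \<psi> x + b * rotation_op \<eta> x))
      \<and> schwartz_continuous_on schwartz_rad
          (rotation_op :: (real \<Rightarrow> complex) \<Rightarrow> real ^ 'n \<Rightarrow> complex)
      \<and> (\<exists>b::nat \<Rightarrow> real. (\<forall>m. b m > 0) \<and>
           (\<forall>\<psi>\<in>schwartz_rad. \<forall>m.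
              schwartz_norm m (rotation_op \<psi> :: real ^ 'n \<Rightarrow> complex)
                \<le> ennreal (b m) * schwartz_norm (4 * m) \<psi>)))
     \<and> ((\<forall>\<phi>\<in>schwartz. (\<forall>r. integrable sphere_measure (\<lambda>\<xi>::real ^ 'n. \<phi> (r *\<^sub>R \<xi>)))
          \<and> averaging_op \<phi> \<in> schwartz_rad)
      \<and> schwartz_continuous_on schwartz
          (averaging_op :: (real ^ 'n \<Rightarrow> complex) \<Rightarrow> real \<Rightarrow> complex)
      \<and> (\<forall>\<phi>\<in>(schwartz :: (real ^ 'n \<Rightarrow> complex) set). \<forall>m.
           schwartz_norm m (averaging_op \<phi>) \<le> of_nat (CARD('n) ^ m) * schwartz_norm m \<phi>))"
    (is "(?wd \<and> ?lin \<and> ?cont \<and> ?bound) \<and> (?awd \<and> ?acont \<and> ?abound)")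
proof (intro conjI)
  show ?wd by (simp add: rotation_op_schwartz_rad)
  show ?lin by (simp add: rotation_op_def fun_eq_iff)
  show ?cont
  proof (rule schwartz_continuous_onI)
    show "\<exists>m' C. \<forall>\<psi>\<in>schwartz_rad. schwartz_norm m (rotation_op \<psi> :: real ^ 'n \<Rightarrow> complex)
        \<le> ennreal C * schwartz_norm m' \<psi>" for m
      using schwartz_norm_rotation_op by blast
  qed (simp_all add: schwartz_rad_diff rotation_op_def fun_eq_iff)
  \<comment> \<open>The constants for the separate \<open>m\<close> are collected into one function
    by choice.\<close>
  show ?bound
    using schwartz_norm_rotation_op[where 'a = "real ^ 'n"] by metis
  have "integrable sphere_measure (\<lambda>\<xi>. \<phi> (r *\<^sub>R \<xi>))"
    if "\<phi> \<in> schwartz" for \<phi> :: "real ^ 'n \<Rightarrow> complex" and r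
    using sphere.integrable_average[OF sphere.weight_one that, of r] by simp
  then show ?awd by (simp add: averaging_op_schwartz_rad)
  have norm_le: "schwartz_norm m (averaging_op \<phi>) \<le> of_nat (CARD('n) ^ m) * schwartz_norm m \<phi>"
    if "\<phi> \<in> schwartz" for \<phi> :: "real ^ 'n \<Rightarrow> complex" and m
    using schwartz_norm_averaging_op[OF that, of m] by (simp add: ennreal_of_nat_eq_real_of_nat)
  then show ?abound by blast
  show ?acont
  proof (rule schwartz_continuous_onI)
    show "\<exists>m' C. \<forall>\<phi>\<in>schwartz. schwartz_norm m (averaging_op \<phi>) \<le> ennreal C * schwartz_norm m' \<phi>" for m
      using schwartz_norm_averaging_op by blast
  qed (simp_all add: schwartz_diff averaging_op_diff)
qed

end
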